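(* Let $\mathbf{k}$ be a field. The non-symmetric operad $\mathcal{T}_{\mathrm{Max}}=(\mathbf{k}\mathcal{T}(n))_{n\ge 1}$, with composition maps given by $T\circ_i^{f_{\mathrm{Max}}}S$ for $T\in\mathcal{T}(n)$, $S\in\mathcal{T}(m)$, $1\le i\le n$, is a free non-symmetric operad.
   Context: Vector spaces are over a field $\mathbf{k}$; $[n]=\{1,\dots,n\}$. Non-symmetric operads. A (reduced) non-symmetric operad is a family of vector spaces $(\mathcal{P}(n))_{n\ge 1}$ with a unit $1\in\mathcal{P}(1)=\mathbf{k}$ and linear maps $\circ_i:\mathcal{P}(n)\otimes\mathcal{P}(m)\to\mathcal{P}(n+m-1)$, $1\le i\le n$, such that for $a\in\mathcal{P}(n)$, $b\in\mathcal{P}(m)$, $c\in\mathcal{P}(\ell)$: $(a\circ_i b)\circ_{j+i-1}c=a\circ_i(b\circ_j c)$ for $1\le i\le n$, $1\le j\le m$; $(a\circ_i b)\circ_j c=(a\circ_j c)\circ_{i+\ell-1}b$ for $1\le j<i\le n$; $1\circ_1 a=a$; $a\circ_i 1=a$. Morphisms are families of linear maps preserving the unit and all $\circ_i$. All operads are reduced. A non-symmetric operad $\mathcal{P}$ is free if there are subspaces $M(n)\subseteq\mathcal{P}(n)$, $n\ge 2$, such that for every non-symmetric operad $\mathcal{Q}$ every family of linear maps $M(n)\to\mathcal{Q}(n)$, $n\ge2$, extends uniquely to a morphism of non-symmetric operads $\mathcal{P}\to\mathcal{Q}$ (equivalently, $\mathcal{P}$ is isomorphic to the free non-symmetric operad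 on a graded vector space $(M(n))_{n\ge 2}$). Labelled rooted trees. $\mathcal{T}(n)$ is the set of $n$-labelled rooted trees, i.e. (non-planar, abstract) trees with vertex set $[n]$ and a distinguished vertex, the root. $\mathbf{k}\mathcal{T}(n)$ is the vector space with basis $\mathcal{T}(n)$. Edges are oriented towards the root; $(a,b)$ denotes an edge oriented from $a$ to $b$, and $E_T$ is the set of oriented edges of $T$. For a vertex $i$ of $T$, $\mathrm{In}(T,i)=\{a : (a,i)\in E_T\}$. Substitution. Let $T\in\mathcal{T}(n)$, $S\in\mathcal{T}(m)$, $1\le i\le n$, let $s$ be the root of $S$, and let $f:\mathrm{In}(T,i)\to[m]$ be a map. For $a\in[n]$, $a\neq i$, put $\tilde a=a$ if $a<i$ and $\tilde a=a+m-1$ if $a>i$. Then $T\circ_i^f S\in\mathcal{T}(n+m-1)$ is the rooted tree (obtained by substituting $S$ for the vertex $i$ of $T$) whose oriented edges are: $(a+i-1,b+i-1)$ for $(a,b)\in E_S$; $(\tilde a,\tilde b)$ for $(a,b)\in E_T$ with $a,b\ne i$; $(\tilde a,f(a)+i-1)$ for $(a,i)\in E_T$; $(s+i-1,\tilde b)$ for $(i,b)\in E_T$. Its root is $s+i-1$ if $i$ is the root of $T$, and $\tilde r$ if the root $r$ of $T$ is different from $i$. The map $f_{\mathrm{Max}}:\mathrm{In}(T,i)\to[m]$ (depending on $i$ and $m$) is defined by $f_{\mathrm{Max}}(k)=m$ if $k<i$ and $f_{\mathrm{Max}}(k)=1$ if $k>i$. The compositions $T\circ_i^{f_{\mathrm{Max}}}S$,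 extended bilinearly, with unit the one-vertex tree, define a non-symmetric operad structure on $(\mathbf{k}\mathcal{T}(n))_{n\ge1}$, denoted $\mathcal{T}_{\mathrm{Max}}$. *)

theory Defs
  imports Complex_Main "HOL-Library.Poly_Mapping"
begin

section \<open>Non-symmetric operads\<close>

text \<open>
  A family of vector spaces is represented as a family of subspaces \<open>comp P n\<close> of one ambient vector
  space (the type \<open>'a\<close> with scalar multiplication \<open>scl P\<close>); this is no restriction, since every family
  embeds in its direct sum. The subspaces may overlap, so partial composition takes the
  arities explicitly: \<open>circ P n m i a b\<close> is $a \circ_i b$ for $a$ of arity $n$ and $b$ of arity $m$.
  Nothing is required of \<open>comp P 0\<close>, nor of \<open>circ\<close> outside the range \<open>1 \<le> i \<le> n\<close>, \<open>1 \<le> m\<close>.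
\<close>

record ('k, 'a) operad =
  scl :: "'k \<Rightarrow> 'a \<Rightarrow> 'a"
  comp :: "nat \<Rightarrow> 'a set"
  one :: "'a"
  circ :: "nat \<Rightarrow> nat \<Rightarrow> nat \<Rightarrow> 'a \<Rightarrow> 'a \<Rightarrow> 'a"

definition linear_map_on ::
  "('k \<Rightarrow> 'a \<Rightarrow> 'a) \<Rightarrow> ('k \<Rightarrow> 'b \<Rightarrow> 'b) \<Rightarrow> 'a set \<Rightarrow> 'b set
    \<Rightarrow> ('a :: ab_group_add \<Rightarrow> 'b :: ab_group_add) \<Rightarrow> bool" where
  "linear_map_on s t A B f \<longleftrightarrow>
     (\<forall>x\<in>A. f x \<in> B) \<and>
     (\<forall>x\<in>A. \<forall>y\<in>A. f (x + y) = f x + f y) \<and>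
     (\<forall>c. \<forall>x\<in>A. f (s c x) = t c (f x))"

text \<open>
  All operads are reduced: \<open>one_nonzero\<close> and \<open>comp_one\<close> say that $P(1) = \mathbf{k}$, spanned by the unit.
\<close>

locale ns_operad = vector_space "scl P"
  for P :: "('k :: field, 'a :: ab_group_add) operad" +
  assumes subspace_comp: "1 \<le> n \<Longrightarrow> subspace (comp P n)"
    and one_nonzero: "one P \<noteq> 0"
    and comp_one: "comp P 1 = range (\<lambda>c. scl P c (one P))"
    and circ_linear_left:
      "1 \<le> i \<Longrightarrow> i \<le> n \<Longrightarrow> 1 \<le> m \<Longrightarrow> b \<in> comp P m \<Longrightarrow>
       linear_map_on (scl P) (scl P) (comp P n) (comp P (n + m - 1)) (\<lambda>a. circ P n m i a b)"
    and circ_linear_right: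
      "1 \<le> i \<Longrightarrow> i \<le> n \<Longrightarrow> 1 \<le> m \<Longrightarrow> a \<in> comp P n \<Longrightarrow>
       linear_map_on (scl P) (scl P) (comp P m) (comp P (n + m - 1)) (\<lambda>b. circ P n m i a b)"
    and circ_sequential:
      "1 \<le> i \<Longrightarrow> i \<le> n \<Longrightarrow> 1 \<le> j \<Longrightarrow> j \<le> m \<Longrightarrow> 1 \<le> l \<Longrightarrow>
       a \<in> comp P n \<Longrightarrow> b \<in> comp P m \<Longrightarrow> c \<in> comp P l \<Longrightarrow>
       circ P (n + m - 1) l (j + i - 1) (circ P n m i a b) c =
       circ P n (m + l - 1) i a (circ P m l j b c)"
    and circ_parallel:
      "1 \<le> j \<Longrightarrow> j < i \<Longrightarrow> i \<le> n \<Longrightarrow> 1 \<le> m \<Longrightarrow> 1 \<le> l \<Longrightarrow>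
       a \<in> comp P n \<Longrightarrow> b \<in> comp P m \<Longrightarrow> c \<in> comp P l \<Longrightarrow>
       circ P (n + m - 1) l j (circ P n m i a b) c =
       circ P (n + l - 1) m (i + l - 1) (circ P n l j a c) b"
    and circ_one_left: "1 \<le> n \<Longrightarrow> a \<in> comp P n \<Longrightarrow> circ P 1 n 1 (one P) a = a"
    and circ_one_right: "1 \<le> i \<Longrightarrow> i \<le> n \<Longrightarrow> a \<in> comp P n \<Longrightarrow> circ P n 1 i a (one P) = a"

definition operad_morphism ::
  "('k, 'a :: ab_group_add) operad \<Rightarrow> ('k, 'b :: ab_group_add) operad \<Rightarrow> (nat \<Rightarrow> 'a \<Rightarrow> 'b) \<Rightarrow> bool" where
  "operad_morphism P Q \<phi> \<longleftrightarrow>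
     (\<forall>n\<ge>1. linear_map_on (scl P) (scl Q) (comp P n) (comp Q n) (\<phi> n)) \<and>
     \<phi> 1 (one P) = one Q \<and>
     (\<forall>n\<ge>1. \<forall>m\<ge>1. \<forall>i\<in>{1..n}. \<forall>a\<in>comp P n. \<forall>b\<in>comp P m.
        \<phi> (n + m - 1) (circ P n m i a b) = circ Q n m i (\<phi> n a) (\<phi> m b))"

definition extends_family ::
  "(nat \<Rightarrow> 'a set) \<Rightarrow> (nat \<Rightarrow> 'a \<Rightarrow> 'b) \<Rightarrow> (nat \<Rightarrow> 'a \<Rightarrow> 'b) \<Rightarrow> bool" where
  "extends_family M g \<phi> \<longleftrightarrow> (\<forall>n\<ge>2. \<forall>x\<in>M n. \<phi> n x = g n x)"

text \<open>
  \<open>freely_generated TYPE('b) P M\<close>: the subspaces $M(n) \subseteq P(n)$, $n \ge 2$, have the universal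
  property of free generators with respect to all operads \<open>Q\<close> carried by the type \<open>'b\<close>.
  (HOL cannot quantify over types inside a formula, hence the type parameter.)
  Uniqueness of a morphism means equality on the components \<open>comp P n\<close>, the values elsewhere being
  irrelevant.
\<close>

definition freely_generated ::
  "'b :: ab_group_add itself \<Rightarrow> ('k :: field, 'a :: ab_group_add) operad \<Rightarrow> (nat \<Rightarrow> 'a set) \<Rightarrow> bool" where
  "freely_generated (_ :: 'b itself) P M \<longleftrightarrow>
     (\<forall>n\<ge>2. module.subspace (scl P) (M n) \<and> M n \<subseteq> comp P n) \<and>
     (\<forall>(Q :: ('k, 'b) operad) g. ns_operad Q \<longrightarrow>
        (\<forall>n\<ge>2. linear_map_on (scl P) (scl Q) (M n) (comp Q n) (g n)) \<longrightarrow>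
        (\<exists>\<phi>. operad_morphism P Q \<phi> \<and> extends_family M g \<phi>) \<and>
        (\<forall>\<phi> \<psi>. operad_morphism P Q \<phi> \<and> extends_family M g \<phi> \<longrightarrow>
               operad_morphism P Q \<psi> \<and> extends_family M g \<psi> \<longrightarrow>
               (\<forall>n\<ge>1. \<forall>x\<in>comp P n. \<phi> n x = \<psi> n x)))"

text \<open>
  Freeness means that some \<open>M\<close> has the universal property for operads carried by every type \<open>'b\<close>.
  The outermost \<open>'b\<close> of a theorem is universally quantified, so stating just
  \<open>\<exists>M. freely_generated TYPE('b) P M\<close> would let \<open>M\<close> depend on \<open>'b\<close>. Instead \<open>M\<close> is chosen by testing
  against operads carried by the type of \<open>P\<close> itself, and every such \<open>M\<close> has to be universal
  for \<open>'b\<close> too. Proved for arbitrary \<open>'b\<close>, this yields one \<open>M\<close> serving all types. This demands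
  nothing extra: if \<open>P\<close> is free, then any \<open>M\<close> passing the test is, like the given free generators, a
  graded complement of the span of the compositions of elements of arity at least 2, so that some
  automorphism of \<open>P\<close> takes one to the other.
\<close>

definition free_operad ::
  "'b :: ab_group_add itself \<Rightarrow> ('k :: field, 'a :: ab_group_add) operad \<Rightarrow> bool" where
  "free_operad (_ :: 'b itself) P \<longleftrightarrow>
     ns_operad P \<and>
     (\<exists>M. freely_generated TYPE('a) P M) \<and>
     (\<forall>M. freely_generated TYPE('a) P M \<longrightarrow> freely_generated TYPE('b) P M)"


section \<open>Labelled rooted trees\<close>

text \<open>Undirected simple graphs on \<open>V\<close> are symmetric irreflexive relations.\<close>

definition graph_cycle :: "('v \<times> 'v) set \<Rightarrow> 'v list \<Rightarrow> bool" where
  "graph_cycle G c \<longleftrightarrow>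
     3 \<le> length c \<and> distinct c \<and> (\<forall>k<length c. (c ! k, c ! (Suc k mod length c)) \<in> G)"

definition tree_graph :: "'v set \<Rightarrow> ('v \<times> 'v) set \<Rightarrow> bool" where
  "tree_graph V G \<longleftrightarrow>
     G \<subseteq> V \<times> V \<and> sym G \<and> irrefl G \<and>
     (\<forall>a\<in>V. \<forall>b\<in>V. (a, b) \<in> G\<^sup>*) \<and>
     (\<nexists>c. graph_cycle G c)"

text \<open>
  A rooted tree is given by its root and its set of oriented edges. The condition
  \<open>edges T \<inter> (edges T)\<inverse> = {}\<close> says that every edge of the underlying tree carries exactly one
  orientation; since that underlying graph is a tree, the edges are all oriented towards the root
  iff every vertex has a directed path to the root.
\<close>

datatype rtree = RTree (root: nat) (edges: "(nat \<times> nat) set")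

definition rooted_trees :: "nat \<Rightarrow> rtree set" where
  "rooted_trees n = {T. root T \<in> {1..n} \<and>
     tree_graph {1..n} (edges T \<union> (edges T)\<inverse>) \<and>
     edges T \<inter> (edges T)\<inverse> = {} \<and>
     (\<forall>a\<in>{1..n}. (a, root T) \<in> (edges T)\<^sup>*)}"

text \<open>In \<open>relabel i m\<close> and \<open>subst_tree i m f T S\<close>, \<open>m\<close> is the number of vertices of \<open>S\<close>.\<close>

definition relabel :: "nat \<Rightarrow> nat \<Rightarrow> nat \<Rightarrow> nat" where
  "relabel i m a = (if a < i then a else a + m - 1)"

definition subst_tree :: "nat \<Rightarrow> nat \<Rightarrow> (nat \<Rightarrow> nat) \<Rightarrow> rtree \<Rightarrow> rtree \<Rightarrow> rtree" where
  "subst_tree i m f T S = RTree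
     (if root T = i then root S + i - 1 else relabel i m (root T))
     ({(a + i - 1, b + i - 1) |a b. (a, b) \<in> edges S} \<union>
      {(relabel i m a, relabel i m b) |a b. (a, b) \<in> edges T \<and> a \<noteq> i \<and> b \<noteq> i} \<union>
      {(relabel i m a, f a + i - 1) |a. (a, i) \<in> edges T} \<union>
      {(root S + i - 1, relabel i m b) |b. (i, b) \<in> edges T})"

definition f_Max :: "nat \<Rightarrow> nat \<Rightarrow> nat \<Rightarrow> nat" where
  "f_Max i m k = (if k < i then m else 1)"


section \<open>The operad of rooted trees\<close>

text \<open>
  The ambient space is the vector space with basis all of \<open>rtree\<close>; $\mathbf{k}\mathcal{T}(n)$ is the span of
  \<open>rooted_trees n\<close>.
\<close>

definition T_Max :: "('k :: field, rtree \<Rightarrow>\<^sub>0 'k) operad" where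
  "T_Max = \<lparr>
     scl = (\<lambda>c. Poly_Mapping.map ((*) c)),
     comp = (\<lambda>n. {x. Poly_Mapping.keys x \<subseteq> rooted_trees n}),
     one = Poly_Mapping.single (RTree 1 {}) 1,
     circ = (\<lambda>n m i x y.
       \<Sum>T\<in>Poly_Mapping.keys x. \<Sum>S\<in>Poly_Mapping.keys y.
         Poly_Mapping.single (subst_tree i m (f_Max i m) T S)
           (Poly_Mapping.lookup x T * Poly_Mapping.lookup y S))\<rparr>"

end

theory Submission
  imports Defs
begin

text \<open>
  The compositions send pairs of trees to trees, so everything reduces to a unique factorization
  property of trees. A factorization $X = T \circ_i S$ is determined by the interval
  $I = [i, i+m-1]$ of the labels of $S$ in $X$. The intervals that occur are those which have exactly
  one outgoing edge and such that every edge entering $I$ from the left ends at $\max I$ and every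
  edge entering it from the right ends at $\min I$. Two such intervals $I$, $J$ cannot overlap
  properly: as an edge from $J \setminus I$ to $I$ would end outside $J$, and the vertices in
  $J \setminus I$ cannot form a cycle, the root of $J$ lies in $J \setminus I$; likewise the root of
  $I$ lies in $I \setminus J$; but then no edge leaves $I \cap J$. So $I$ and $J$ are disjoint or
  nested, and the two factorizations have a common refinement, related to them by the parallel or
  the sequential axiom. Hence a map on the indecomposable trees extends to all trees by induction on
  the number of vertices, independently of the chosen factorizations.

  The generators for operads carried by one type serve for every other type because any free
  generators form a graded complement of the span of the decomposable elements.
\<close>


section \<open>Free generators and decomposable elements\<close>

text \<open>The rule \<open>f_Max\<close> is what makes an interval determine its factorization: an
  edge entering the block has a prescribed end point, so contracting the block loses nothing, and
  comparing factorizations becomes comparing intervals. Sets of edges are awkward for this. With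
  parent functions, equality of trees is pointwise and composition is a formula by ranges of labels.
  Acyclicity takes the form that every nonempty set of vertices contains one whose parent lies
  outside the set; this form passes through contraction and expansion of a block and is exactly what
  the overlap argument consumes. Independence of the chosen factorization is a diamond argument: it
  suffices to compare two factorizations of one element in a single step, since the factors in a
  common refinement have smaller arity. The passage between types has its own obstacle. An arbitrary
  family of generators is only known to be universal for operads on the carrier type of
  \<open>P\<close>, so the operad that detects indecomposable elements must be built on that type.
  This dictates a square-zero operad on the ambient space itself instead of on a quotient.\<close>

lemma linear_map_onI:
  assumes "\<And>x. x \<in> A \<Longrightarrow> f x \<in> B" "\<And>x y. x \<in> A \<Longrightarrow> y \<in> A \<Longrightarrow> f (x + y) = f x + f y"
    and "\<And>c x. x \<in> A \<Longrightarrow> f (s c x) = t c (f x)"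
  shows "linear_map_on s t A B f"
  using assms by (simp add: linear_map_on_def)

lemma linear_map_onD:
  assumes "linear_map_on s t A B f"
  shows "x \<in> A \<Longrightarrow> f x \<in> B" "x \<in> A \<Longrightarrow> y \<in> A \<Longrightarrow> f (x + y) = f x + f y"
    and "x \<in> A \<Longrightarrow> f (s c x) = t c (f x)"
  using assms by (simp_all add: linear_map_on_def)

lemma linear_map_on_compose:
  "linear_map_on s t A B f \<Longrightarrow> linear_map_on t u B C g \<Longrightarrow> linear_map_on s u A C (\<lambda>x. g (f x))"
  by (simp add: linear_map_on_def)

lemma linear_map_on_subset:
  "linear_map_on s t A B f \<Longrightarrow> A' \<subseteq> A \<Longrightarrow> (\<And>x. x \<in> A' \<Longrightarrow> f x \<in> B') \<Longrightarrow> linear_map_on s t A' B' f"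
  unfolding linear_map_on_def by blast

lemma linear_map_on_0:
  assumes "vector_space s" "vector_space t" "linear_map_on s t A B f" "0 \<in> A"
  shows "f 0 = 0"
proof -
  interpret S: vector_space s by fact
  interpret T: vector_space t by fact
  have "f (s 0 0) = t 0 (f 0)" using linear_map_onD(3)[OF assms(3,4)] .
  thus ?thesis by simp
qed

lemma operad_morphismD:
  assumes "operad_morphism P Q \<phi>"
  shows "1 \<le> n \<Longrightarrow> linear_map_on (scl P) (scl Q) (comp P n) (comp Q n) (\<phi> n)"
    and "\<phi> 1 (one P) = one Q"
    and "1 \<le> i \<Longrightarrow> i \<le> n \<Longrightarrow> 1 \<le> m \<Longrightarrow> a \<in> comp P n \<Longrightarrow> b \<in> comp P m \<Longrightarrow>
      \<phi> (n + m - 1) (circ P n m i a b) = circ Q n m i (\<phi> n a) (\<phi> m b)"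
  using assms unfolding operad_morphism_def by auto

lemma operad_morphismI:
  assumes "\<And>n. 1 \<le> n \<Longrightarrow> linear_map_on (scl P) (scl Q) (comp P n) (comp Q n) (\<phi> n)"
    and "\<phi> 1 (one P) = one Q"
    and "\<And>n m i a b. 1 \<le> i \<Longrightarrow> i \<le> n \<Longrightarrow> 1 \<le> m \<Longrightarrow> a \<in> comp P n \<Longrightarrow> b \<in> comp P m \<Longrightarrow>
      \<phi> (n + m - 1) (circ P n m i a b) = circ Q n m i (\<phi> n a) (\<phi> m b)"
  shows "operad_morphism P Q \<phi>"
  using assms unfolding operad_morphism_def by simp

lemma operad_morphism_compose:
  assumes \<phi>: "operad_morphism P Q \<phi>" and \<psi>: "operad_morphism Q R \<psi>"
  shows "operad_morphism P R (\<lambda>n x. \<psi> n (\<phi> n x))"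
proof (rule operad_morphismI)
  show "linear_map_on (scl P) (scl R) (comp P n) (comp R n) (\<lambda>x. \<psi> n (\<phi> n x))" if "1 \<le> n" for n
    using linear_map_on_compose[OF operad_morphismD(1)[OF \<phi> that] operad_morphismD(1)[OF \<psi> that]] .
  show "\<psi> 1 (\<phi> 1 (one P)) = one R"
    using operad_morphismD(2)[OF \<phi>] operad_morphismD(2)[OF \<psi>] by simp
next
  fix n m i a b
  assume im: "1 \<le> i" "i \<le> n" "1 \<le> m" and ab: "a \<in> comp P n" "b \<in> comp P m"
  have "\<phi> n a \<in> comp Q n" "\<phi> m b \<in> comp Q m"
    using linear_map_onD(1)[OF operad_morphismD(1)[OF \<phi>]] im ab by auto
  thus "\<psi> (n + m - 1) (\<phi> (n + m - 1) (circ P n m i a b)) = circ R n m i (\<psi> n (\<phi> n a)) (\<psi> m (\<phi> m b))"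
    using operad_morphismD(3)[OF \<phi> im ab] operad_morphismD(3)[OF \<psi> im] by simp
qed

lemma operad_morphism_id: "operad_morphism P P (\<lambda>n x. x)"
  unfolding operad_morphism_def linear_map_on_def by auto

lemma freely_generatedD:
  fixes Q :: "('k :: field, 'b :: ab_group_add) operad"
  assumes "freely_generated TYPE('b) P M"
  shows "2 \<le> n \<Longrightarrow> module.subspace (scl P) (M n)" "2 \<le> n \<Longrightarrow> M n \<subseteq> comp P n"
    and "ns_operad Q \<Longrightarrow> (\<And>n. 2 \<le> n \<Longrightarrow> linear_map_on (scl P) (scl Q) (M n) (comp Q n) (g n)) \<Longrightarrow>
      \<exists>\<phi>. operad_morphism P Q \<phi> \<and> extends_family M g \<phi>"
    and "ns_operad Q \<Longrightarrow> (\<And>n. 2 \<le> n \<Longrightarrow> linear_map_on (scl P) (scl Q) (M n) (comp Q n) (g n)) \<Longrightarrow>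
      operad_morphism P Q \<phi> \<Longrightarrow> extends_family M g \<phi> \<Longrightarrow>
      operad_morphism P Q \<psi> \<Longrightarrow> extends_family M g \<psi> \<Longrightarrow> 1 \<le> n \<Longrightarrow> x \<in> comp P n \<Longrightarrow> \<phi> n x = \<psi> n x"
  using assms unfolding freely_generated_def by blast+

section \<open>Indecomposables of an operad and the square-zero test operad\<close>

context ns_operad
begin

lemma circ_closed:
  "1 \<le> i \<Longrightarrow> i \<le> n \<Longrightarrow> 1 \<le> m \<Longrightarrow> a \<in> comp P n \<Longrightarrow> b \<in> comp P m \<Longrightarrow> circ P n m i a b \<in> comp P (n + m - 1)"
  using linear_map_onD(1)[OF circ_linear_left] by blast

lemma one_in_comp: "one P \<in> comp P 1"
  unfolding comp_one using scale_one by (metis rangeI)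

text \<open>In arity \<open>n\<close> this is the square of the augmentation ideal, the ideal being
  formed by the components of arity at least 2.\<close>

definition decomposables :: "nat \<Rightarrow> 'a set" where
  "decomposables n = span {circ P p q i a b |p q i a b.
     2 \<le> p \<and> 2 \<le> q \<and> n = p + q - 1 \<and> 1 \<le> i \<and> i \<le> p \<and> a \<in> comp P p \<and> b \<in> comp P q}"

text \<open>The identification of the arity 1 component with the field; the description is
  meaningful on multiples of the unit, where \<open>one_nonzero\<close> makes the coefficient
  unique.\<close>

definition unit_coeff :: "'a \<Rightarrow> 'k" where
  "unit_coeff a = (THE c. a = scl P c (one P))"

lemma unit_coeff_scl: "unit_coeff (scl P c (one P)) = c"
  unfolding unit_coeff_def using one_nonzero by (intro the_equality) auto

text \<open>
  The two halves of the universal property with respect to the following operad yield that free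
  generators form a complement of the decomposables: morphisms into it kill the decomposables, and
  any linear map that kills them is a component of a morphism.
\<close>

definition square_zero :: "('k, 'a) operad" where
  "square_zero = \<lparr>scl = scl P, comp = (\<lambda>n. if n = 1 then comp P 1 else UNIV), one = one P,
     circ = (\<lambda>n m i a b. if n = 1 then scl P (unit_coeff a) b
       else if m = 1 then scl P (unit_coeff b) a else 0)\<rparr>"

lemma square_zero_simps:
  "scl square_zero = scl P" "comp square_zero n = (if n = 1 then comp P 1 else UNIV)"
  "one square_zero = one P"
  "circ square_zero n m i a b = (if n = 1 then scl P (unit_coeff a) b
       else if m = 1 then scl P (unit_coeff b) a else 0)"
  by (simp_all add: square_zero_def)

lemma ns_operad_square_zero: "ns_operad square_zero"
proof -
  have one: "\<exists>c. a = scl P c (one P)" if "a \<in> comp P 1" for a using that comp_one by auto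
  have uadd: "unit_coeff (a + b) = unit_coeff a + unit_coeff b" if "a \<in> comp P 1" "b \<in> comp P 1" for a b
    using one[OF that(1)] one[OF that(2)] by (auto simp: unit_coeff_scl simp flip: scale_left_distrib)
  have uscl: "unit_coeff (scl P c a) = c * unit_coeff a" if "a \<in> comp P 1" for a c
    using one[OF that] by (auto simp: unit_coeff_scl)
  have u0: "unit_coeff 0 = 0" using unit_coeff_scl[of 0] by simp
  have u1: "unit_coeff (one P) = 1" using unit_coeff_scl[of 1] by simp
  have sub1: "subspace (comp P 1)" by (rule subspace_comp) simp
  have mult1: "scl P (unit_coeff a) b \<in> comp P 1" if "b \<in> comp P 1" for a b
    using subspace_scale[OF sub1 that] .
  have swap: "scl P (unit_coeff a) b = scl P (unit_coeff b) a" if "a \<in> comp P 1" "b \<in> comp P 1" for a b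
    using one[OF that(1)] one[OF that(2)] by (auto simp: unit_coeff_scl mult.commute)
  show ?thesis
  proof (unfold_locales, unfold square_zero_simps, goal_cases)
    case 1 show ?case by (rule scale_right_distrib)
  next
    case 2 show ?case by (rule scale_left_distrib)
  next
    case 3 show ?case by (rule scale_scale)
  next
    case 4 show ?case by (rule scale_one)
  next
    case (5 n) show ?case using sub1 by simp
  next
    case 6 show ?case by (rule one_nonzero)
  next
    case 7 show ?case using comp_one by simp
  next
    case (8 i n m b)
    thus ?case unfolding linear_map_on_def
      using mult1 by (auto simp: uadd uscl algebra_simps split: if_splits)
  next
    case (9 i n m a)
    thus ?case unfolding linear_map_on_def
      using mult1 by (auto simp: uadd uscl algebra_simps split: if_splits)
  next
    \<comment> \<open>If two of the three arities exceed 1, both sides vanish. Otherwise at least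
      two of the elements are multiples of the unit, and both sides are the remaining one scaled by
      their coefficients.\<close>
    case (10 i n j m l a b c)
    consider "n = 1" "m = 1" | "n = 1" "2 \<le> m" "l = 1" | "n = 1" "2 \<le> m" "2 \<le> l"
      | "2 \<le> n" "m = 1" "l = 1" | "2 \<le> n" "m = 1" "2 \<le> l"
      | "2 \<le> n" "2 \<le> m" using 10(1-5) by linarith
    then show ?case
      using 10 by cases (simp_all add: uscl u0 mult.commute)
  next
    case (11 j i n m l a b c)
    thus ?case by (auto simp: mult.commute)
  next
    case (12 n a) thus ?case by (simp add: u1)
  next
    case (13 i n a) 
    thus ?case using swap[of a "one P"] one_in_comp by (auto simp: u1)
  qed
qed

text \<open>A basis of \<open>V\<close> stays independent when \<open>x\<close> is added, so sending
  \<open>x\<close> to itself and the basis to 0 extends linearly. The values stay in the ambient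
  space because the test operad lives there.\<close>

lemma linear_zero_on_subspace:
  assumes V: "subspace V" and x: "x \<notin> V"
  obtains f where "Vector_Spaces.linear (scl P) (scl P) f" "f x \<noteq> 0" "\<And>v. v \<in> V \<Longrightarrow> f v = 0"
proof -
  interpret vector_space_pair "scl P" "scl P" ..
  obtain B where B: "B \<subseteq> V" "independent B" "V \<subseteq> span B" by (rule maximal_independent_subset)
  have sp: "span B = V" using span_subspace[OF B(1,3) V] .
  have "independent (insert x B)" using independent_insertI[OF _ B(2)] x sp by blast
  then obtain f where f: "Vector_Spaces.linear (scl P) (scl P) f" "\<forall>y\<in>insert x B. f y = (if y = x then x else 0)"
    using linear_independent_extend[of "insert x B" "\<lambda>y. if y = x then x else 0"] by blast
  have "f y = 0" if "y \<in> B" for y using f(2) that B(1) x by auto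
  hence "f v = 0" if "v \<in> V" for v
    using linear_eq_0_on_span[OF f(1), of B] sp that by blast
  moreover have "x \<noteq> 0" using subspace_0[OF V] x by blast
  ultimately show thesis using that f by auto
qed

text \<open>Existence of extensions gives the trivial intersection, uniqueness of extensions gives
  that the sum is everything.\<close>

lemma generators_complement:
  assumes M: "freely_generated TYPE('a) P M" and n: "2 \<le> n"
  shows "M n \<inter> decomposables n \<subseteq> {0}"
    and "x \<in> comp P n \<Longrightarrow> \<exists>m\<in>M n. x - m \<in> decomposables n"
proof -
  note Z = ns_operad_square_zero
  have vs: "vector_space (scl P)" ..
  show "M n \<inter> decomposables n \<subseteq> {0}"
  proof
    fix x assume x: "x \<in> M n \<inter> decomposables n"
    \<comment> \<open>The inclusion of \<open>M\<close> extends to a morphism that fixes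
      \<open>M\<close> and annihilates all decomposables, so an element of both is 0.\<close>
    have "linear_map_on (scl P) (scl square_zero) (M k) (comp square_zero k) (\<lambda>x. x)" if "2 \<le> k" for k
      using that by (intro linear_map_onI) (auto simp: square_zero_simps)
    then obtain \<phi> where \<phi>: "operad_morphism P square_zero \<phi>" "extends_family M (\<lambda>n x. x) \<phi>"
      using freely_generatedD(3)[OF M Z, of "\<lambda>n x. x"] by blast
    have lin: "linear_map_on (scl P) (scl square_zero) (comp P n) (comp square_zero n) (\<phi> n)"
      using operad_morphismD(1)[OF \<phi>(1)] n by auto
    have sub: "subspace (comp P n)" using subspace_comp n by auto
    have 0: "\<phi> n 0 = 0"
      using linear_map_on_0[OF vs _ lin subspace_0[OF sub]] vs by (simp add: square_zero_simps)
    have "x \<in> comp P n \<and> \<phi> n x = 0"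
    proof -
      have "subspace {y \<in> comp P n. \<phi> n y = 0}"
        using 0 subspace_0[OF sub] subspace_add[OF sub] subspace_scale[OF sub] linear_map_onD[OF lin]
        by (auto simp: subspace_def square_zero_simps)
      moreover have "circ P p q i a b \<in> {y \<in> comp P n. \<phi> n y = 0}"
        if "2 \<le> p" "2 \<le> q" "n = p + q - 1" "1 \<le> i" "i \<le> p" "a \<in> comp P p" "b \<in> comp P q" for p q i a b
        using operad_morphismD(3)[OF \<phi>(1), of i p q a b] circ_closed[of i p q a b] that
        by (auto simp: square_zero_simps)
      ultimately have "decomposables n \<subseteq> {y \<in> comp P n. \<phi> n y = 0}"
        unfolding decomposables_def by (intro span_minimal) blast+
      thus ?thesis using x by blast
    qed
    moreover have "\<phi> n x = x" using \<phi>(2) x n unfolding extends_family_def by blast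
    ultimately show "x \<in> {0}" by simp
  qed
  assume x: "x \<in> comp P n"
  let ?V = "{m + d |m d. m \<in> M n \<and> d \<in> decomposables n}"
  have Mn: "subspace (M n)" "M n \<subseteq> comp P n" using freely_generatedD(1,2)[OF M n] by auto
  have Dn: "subspace (decomposables n)" unfolding decomposables_def by (rule subspace_span)
  have V: "subspace ?V" by (rule subspace_sums[OF Mn(1) Dn])
  have MV: "M n \<subseteq> ?V"
  proof
    fix m assume "m \<in> M n"
    hence "m = m + 0 \<and> m \<in> M n \<and> 0 \<in> decomposables n" using subspace_0[OF Dn] by simp
    thus "m \<in> ?V" by blast
  qed
  have DV: "decomposables n \<subseteq> ?V"
  proof
    fix m assume "m \<in> decomposables n"
    hence "m = 0 + m \<and> 0 \<in> M n \<and> m \<in> decomposables n" using subspace_0[OF Mn(1)] by simp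
    thus "m \<in> ?V" by blast
  qed
  have "x \<in> ?V"
  proof (rule ccontr)
    assume "x \<notin> ?V"
    then obtain f where f: "Vector_Spaces.linear (scl P) (scl P) f" "f x \<noteq> 0" "\<And>v. v \<in> ?V \<Longrightarrow> f v = 0"
      using linear_zero_on_subspace[OF V] by blast
    have fadd: "f (a + b) = f a + f b" and fscl: "f (scl P c a) = scl P c (f a)" for a b c
      using f(1) by (simp_all add: linear_iff_module_hom module_hom.add module_hom.scale)
    \<comment> \<open>An endomorphism \<open>h\<close> of the ambient space is placed in arity
      \<open>n\<close> alone, next to the identity in arity 1. Since products of elements of arity
      at least 2 are 0 in \<open>square_zero\<close>, multiplicativity only asks that
      \<open>h\<close> kill the decomposables.\<close>
    define \<theta> where "\<theta> h k y = (if k = n then h y else if k = 1 then y else (0::'a))" for h :: "'a \<Rightarrow> 'a" and k :: nat and y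
    have mor: "operad_morphism P square_zero (\<theta> h)"
      if hadd: "\<And>a b. h (a + b) = h a + h b" and hscl: "\<And>c a. h (scl P c a) = scl P c (h a)"
        and hD: "\<And>d. d \<in> decomposables n \<Longrightarrow> h d = 0" for h
    proof -
      have \<theta>scl: "\<theta> h k (scl P c a) = scl P c (\<theta> h k a)" for k c a
        by (simp add: \<theta>_def hscl)
      have "linear_map_on (scl P) (scl square_zero) (comp P k) (comp square_zero k) (\<theta> h k)" if "1 \<le> k" for k
        using n by (intro linear_map_onI) (auto simp: square_zero_simps \<theta>_def hadd hscl)
      moreover have "\<theta> h 1 (one P) = one square_zero" using n by (simp add: \<theta>_def square_zero_simps)
      moreover have "\<theta> h (p + q - 1) (circ P p q i a b) = circ square_zero p q i (\<theta> h p a) (\<theta> h q b)"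
        if pq: "1 \<le> p" "1 \<le> q" "i \<in> {1..p}" and a: "a \<in> comp P p" and b: "b \<in> comp P q" for p q i a b
      proof -
        consider "p = 1" | "p \<noteq> 1" "q = 1" | "2 \<le> p" "2 \<le> q" using pq by linarith
        then show ?thesis
        proof cases
          case 1
          hence i: "i = 1" using pq by auto
          obtain c where c: "a = scl P c (one P)" using a 1 comp_one by auto
          have "circ P p q i a b = scl P c (circ P 1 q 1 (one P) b)"
            using linear_map_onD(3)[OF circ_linear_left[of 1 1 q b] one_in_comp, of c] pq(2) b 
            unfolding 1 i c by simp
          also have "\<dots> = scl P c b" using circ_one_left[OF pq(2) b] by simp
          finally show ?thesis using 1 n c by (simp add: square_zero_simps \<theta>scl) (simp add: \<theta>_def unit_coeff_scl)
        next
          case 2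
          obtain c where c: "b = scl P c (one P)" using b 2 comp_one by auto
          have "circ P p q i a b = scl P c (circ P p 1 i a (one P))"
            using linear_map_onD(3)[OF circ_linear_right[of i p 1 a] one_in_comp, of c] pq a 
            unfolding 2 c by simp
          also have "\<dots> = scl P c a" using circ_one_right[of i p a] pq a by simp
          finally show ?thesis using 2 n c by (simp add: square_zero_simps \<theta>scl) (simp add: \<theta>_def unit_coeff_scl)
        next
          case 3
          have "circ P p q i a b \<in> decomposables n" if "n = p + q - 1"
            unfolding decomposables_def
          proof (rule span_base, intro CollectI exI conjI)
            show "circ P p q i a b = circ P p q i a b" ..
          qed (use 3 pq a b that in auto)
          thus ?thesis using 3 hD by (auto simp: square_zero_simps \<theta>_def)
        qed
      qed
      ultimately show ?thesis by (intro operad_morphismI) auto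
    qed
    have m0: "operad_morphism P square_zero (\<theta> (\<lambda>_. 0))" by (rule mor) auto
    have mf: "operad_morphism P square_zero (\<theta> f)" by (rule mor[OF fadd fscl f(3)]) (use DV in blast)
    have ext: "extends_family M (\<lambda>_ _. 0) (\<theta> h)" if "\<And>m. m \<in> M n \<Longrightarrow> h m = 0" for h
      using that n by (auto simp: extends_family_def \<theta>_def)
    \<comment> \<open>Both morphisms vanish on all of \<open>M\<close>, so uniqueness identifies
      them, although they differ at \<open>x\<close>.\<close>
    have "\<theta> f n x = \<theta> (\<lambda>_. 0) n x"
    proof (rule freely_generatedD(4)[OF M Z _ mf _ m0])
      show "linear_map_on (scl P) (scl square_zero) (M n) (comp square_zero n) ((\<lambda>_ _. 0) n)" if "2 \<le> n" for n
        using that by (intro linear_map_onI) (auto simp: square_zero_simps)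
      show "extends_family M (\<lambda>_ _. 0) (\<theta> f)" by (rule ext) (use f(3) MV in blast)
      show "extends_family M (\<lambda>_ _. 0) (\<theta> (\<lambda>_. 0))" by (rule ext) simp
      show "1 \<le> n" using n by simp
    qed fact
    thus False using f(2) by (simp add: \<theta>_def)
  qed
  then obtain m d where "x = m + d" "m \<in> M n" "d \<in> decomposables n" by blast
  thus "\<exists>m\<in>M n. x - m \<in> decomposables n" by (intro bexI[of _ m]) auto
qed

section \<open>Projections onto generators along the decomposables, and change of generators\<close>

definition generator_part :: "(nat \<Rightarrow> 'a set) \<Rightarrow> nat \<Rightarrow> 'a \<Rightarrow> 'a" where
  "generator_part M n x = (THE m. m \<in> M n \<and> x - m \<in> decomposables n)"

lemma generator_part:
  assumes M: "freely_generated TYPE('a) P M" and n: "2 \<le> n"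
  shows "m \<in> M n \<Longrightarrow> x - m \<in> decomposables n \<Longrightarrow> generator_part M n x = m"
    and "x \<in> comp P n \<Longrightarrow> generator_part M n x \<in> M n"
    and "x \<in> comp P n \<Longrightarrow> x - generator_part M n x \<in> decomposables n"
    and "linear_map_on (scl P) (scl P) (comp P n) (M n) (generator_part M n)"
proof -
  have Mn: "subspace (M n)" "M n \<subseteq> comp P n" using freely_generatedD(1,2)[OF M n] by auto
  have Dn: "subspace (decomposables n)" unfolding decomposables_def by (rule subspace_span)
  have uniq: "m = m'" if "m \<in> M n" "x - m \<in> decomposables n" "m' \<in> M n" "x - m' \<in> decomposables n" for m m' x
  proof -
    have "(x - m') - (x - m) \<in> decomposables n" using subspace_diff[OF Dn that(4,2)] .
    hence "m - m' \<in> decomposables n" by simp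
    moreover have "m - m' \<in> M n" using subspace_diff[OF Mn(1) that(1,3)] .
    ultimately show ?thesis using generators_complement(1)[OF M n] by auto
  qed
  show eq: "generator_part M n x = m" if "m \<in> M n" "x - m \<in> decomposables n" for m x
    unfolding generator_part_def using that uniq by (intro the_equality) blast+
  show in_M: "generator_part M n x \<in> M n" and in_D: "x - generator_part M n x \<in> decomposables n"
    if "x \<in> comp P n" for x
    using generators_complement(2)[OF M n that] eq by auto
  have sub: "subspace (comp P n)" using subspace_comp n by auto
  show "linear_map_on (scl P) (scl P) (comp P n) (M n) (generator_part M n)"
  proof (rule linear_map_onI)
    fix x y assume x: "x \<in> comp P n" and y: "y \<in> comp P n"
    show "generator_part M n (x + y) = generator_part M n x + generator_part M n y"
    proof (rule eq)
      show "generator_part M n x + generator_part M n y \<in> M n" using in_M x y subspace_add[OF Mn(1)] by blast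
      show "x + y - (generator_part M n x + generator_part M n y) \<in> decomposables n"
        using subspace_add[OF Dn in_D[OF x] in_D[OF y]] by (simp add: algebra_simps)
    qed
  next
    fix c x assume x: "x \<in> comp P n"
    show "generator_part M n (scl P c x) = scl P c (generator_part M n x)"
    proof (rule eq)
      show "scl P c (generator_part M n x) \<in> M n" using in_M x subspace_scale[OF Mn(1)] by blast
      show "scl P c x - scl P c (generator_part M n x) \<in> decomposables n"
        using subspace_scale[OF Dn in_D[OF x], of c] by (simp add: scale_right_diff_distrib)
    qed
  qed (rule in_M)
qed

text \<open>An element and its projection to \<open>N\<close> agree modulo decomposables, so
  projecting back to \<open>M\<close> recovers the element.\<close>

lemma generator_part_inverse:
  assumes M: "freely_generated TYPE('a) P M" and N: "freely_generated TYPE('a) P N" and n: "2 \<le> n"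
    and x: "x \<in> M n"
  shows "generator_part M n (generator_part N n x) = x"
proof (rule generator_part(1)[OF M n x])
  have "x \<in> comp P n" using freely_generatedD(2)[OF M n] x by blast
  hence "x - generator_part N n x \<in> decomposables n" by (rule generator_part(3)[OF N n])
  hence "- (x - generator_part N n x) \<in> decomposables n"
    unfolding decomposables_def by (rule span_neg)
  thus "generator_part N n x - x \<in> decomposables n" by simp
qed

text \<open>
  Two graded complements of the decomposables are identified by the projections along the
  decomposables, and these extend to mutually inverse endomorphisms of \<open>P\<close>.
\<close>

lemma freely_generated_transfer:
  fixes M N :: "nat \<Rightarrow> 'a set"
  assumes N: "freely_generated TYPE('a) P N" and N': "freely_generated TYPE('b :: ab_group_add) P N"
    and M: "freely_generated TYPE('a) P M"
  shows "freely_generated TYPE('b) P M"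
proof -
  have P: "ns_operad P" ..
  have lin: "linear_map_on (scl P) (scl P) (K n) (K' n) (generator_part K' n)"
    if "freely_generated TYPE('a) P K" "freely_generated TYPE('a) P K'" "2 \<le> n" for K K' :: "nat \<Rightarrow> 'a set" and n
    using generator_part(4)[OF that(2,3)] freely_generatedD(2)[OF that(1,3)] generator_part(2)[OF that(2,3)]
    by (blast intro: linear_map_on_subset)
  have lin': "linear_map_on (scl P) (scl P) (K n) (comp P n) (generator_part K' n)"
    if "freely_generated TYPE('a) P K" "freely_generated TYPE('a) P K'" "2 \<le> n" for K K' :: "nat \<Rightarrow> 'a set" and n
    using lin[OF that] freely_generatedD(2)[OF that(2,3)] by (fastforce simp: linear_map_on_def)
  obtain \<phi> where \<phi>: "operad_morphism P P \<phi>" "extends_family N (generator_part M) \<phi>"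
    using freely_generatedD(3)[OF N P, of "generator_part M"] lin'[OF N M] by blast
  obtain \<psi> where \<psi>: "operad_morphism P P \<psi>" "extends_family M (generator_part N) \<psi>"
    using freely_generatedD(3)[OF M P, of "generator_part N"] lin'[OF M N] by blast
  have MN: "generator_part N n m \<in> N n" if "2 \<le> n" "m \<in> M n" for n m
    using linear_map_onD(1)[OF lin[OF M N that(1)] that(2)] .
  have NM: "generator_part M n m \<in> M n" if "2 \<le> n" "m \<in> N n" for n m
    using linear_map_onD(1)[OF lin[OF N M that(1)] that(2)] .
  \<comment> \<open>Both the composite and the identity extend the inclusion of \<open>M\<close>;
    uniqueness is applied with \<open>P\<close> as its own test operad.\<close>
  have inv: "\<phi> n (\<psi> n x) = x" if "1 \<le> n" "x \<in> comp P n" for n x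
  proof (rule freely_generatedD(4)[OF M P, where g = "\<lambda>n x. x"])
    show "linear_map_on (scl P) (scl P) (M n) (comp P n) (\<lambda>x. x)" if "2 \<le> n" for n
      using freely_generatedD(2)[OF M that] by (auto simp: linear_map_on_def)
    show "operad_morphism P P (\<lambda>n x. \<phi> n (\<psi> n x))" by (rule operad_morphism_compose[OF \<psi>(1) \<phi>(1)])
    show "extends_family M (\<lambda>n x. x) (\<lambda>n x. \<phi> n (\<psi> n x))"
      using \<phi>(2) \<psi>(2) MN generator_part_inverse[OF M N] unfolding extends_family_def by simp
    show "operad_morphism P P (\<lambda>n x. x)" by (rule operad_morphism_id)
    show "extends_family M (\<lambda>n x. x) (\<lambda>n x. x)" by (simp add: extends_family_def)
  qed fact+
  have main: "(\<exists>\<chi>. operad_morphism P Q \<chi> \<and> extends_family M g \<chi>) \<and>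
        (\<forall>\<chi> \<chi>'. operad_morphism P Q \<chi> \<and> extends_family M g \<chi> \<longrightarrow>
               operad_morphism P Q \<chi>' \<and> extends_family M g \<chi>' \<longrightarrow>
               (\<forall>n\<ge>1. \<forall>x\<in>comp P n. \<chi> n x = \<chi>' n x))"
    if Q: "ns_operad Q" and g: "\<forall>n\<ge>2. linear_map_on (scl P) (scl Q) (M n) (comp Q n) (g n)"
    for Q :: "('k, 'b) operad" and g
  proof -
    \<comment> \<open>The data on \<open>M\<close> are pulled back to \<open>N\<close>, the only
      family known to be universal for the type \<open>'b\<close>; the extension obtained there is
      carried to \<open>M\<close> by precomposing with \<open>\<psi>\<close>.\<close>
    let ?g = "\<lambda>n x. g n (generator_part M n x)"
    have lg: "linear_map_on (scl P) (scl Q) (N n) (comp Q n) (?g n)" if "2 \<le> n" for n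
      using linear_map_on_compose[OF lin[OF N M that]] g that by blast
    obtain \<Phi> where \<Phi>: "operad_morphism P Q \<Phi>" "extends_family N ?g \<Phi>"
      using freely_generatedD(3)[OF N' Q, of ?g] lg by blast
    have "operad_morphism P Q (\<lambda>n x. \<Phi> n (\<psi> n x))" by (rule operad_morphism_compose[OF \<psi>(1) \<Phi>(1)])
    moreover have "extends_family M g (\<lambda>n x. \<Phi> n (\<psi> n x))"
      using \<Phi>(2) \<psi>(2) MN generator_part_inverse[OF M N] unfolding extends_family_def by simp
    moreover have "\<chi> n x = \<chi>' n x"
      if \<chi>: "operad_morphism P Q \<chi>" "extends_family M g \<chi>" and \<chi>': "operad_morphism P Q \<chi>'" "extends_family M g \<chi>'"
        and n: "1 \<le> n" and x: "x \<in> comp P n" for \<chi> \<chi>' n x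
    proof -
      \<comment> \<open>Conversely, precomposing with \<open>\<phi>\<close> turns extensions from
        \<open>M\<close> into extensions from \<open>N\<close>, where uniqueness holds;
        \<open>inv\<close> then cancels the detour.\<close>
      have ext: "extends_family N ?g (\<lambda>n x. \<omega> n (\<phi> n x))" if "extends_family M g \<omega>" for \<omega>
        using that \<phi>(2) NM unfolding extends_family_def by simp
      have "\<psi> n x \<in> comp P n" using linear_map_onD(1)[OF operad_morphismD(1)[OF \<psi>(1) n] x] .
      hence "\<chi> n (\<phi> n (\<psi> n x)) = \<chi>' n (\<phi> n (\<psi> n x))"
        using freely_generatedD(4)[OF N' Q, of ?g "\<lambda>n x. \<chi> n (\<phi> n x)" "\<lambda>n x. \<chi>' n (\<phi> n x)" n "\<psi> n x"]
          lg ext \<chi> \<chi>' operad_morphism_compose[OF \<phi>(1)] n by blast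
      thus ?thesis using inv[OF n x] by simp
    qed
    ultimately show ?thesis by blast
  qed
  show ?thesis unfolding freely_generated_def
    using main freely_generatedD(1,2)[OF M] by blast
qed

end

section \<open>Linearization of set operads\<close>

abbreviation scale_pm :: "'k :: field \<Rightarrow> ('t \<Rightarrow>\<^sub>0 'k) \<Rightarrow> 't \<Rightarrow>\<^sub>0 'k" where
  "scale_pm c \<equiv> Poly_Mapping.map ((*) c)"

abbreviation basis :: "'t \<Rightarrow> 't \<Rightarrow>\<^sub>0 'k :: field" where
  "basis t \<equiv> Poly_Mapping.single t 1"

lemma lookup_scale_pm: "Poly_Mapping.lookup (scale_pm c x) t = c * Poly_Mapping.lookup x t"
  by (simp add: Poly_Mapping.map.rep_eq when_def)

lemma scale_pm_single: "scale_pm c (Poly_Mapping.single t a) = Poly_Mapping.single t (c * a)"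
  by (rule poly_mapping_eqI) (simp add: lookup_scale_pm lookup_single when_def)

interpretation pm: vector_space "scale_pm :: 'k :: field \<Rightarrow> ('t \<Rightarrow>\<^sub>0 'k) \<Rightarrow> 't \<Rightarrow>\<^sub>0 'k"
  by unfold_locales (auto intro!: poly_mapping_eqI simp: lookup_scale_pm lookup_add algebra_simps)

lemma keys_scale_pm: "Poly_Mapping.keys (scale_pm c x) \<subseteq> Poly_Mapping.keys x"
  by (auto simp: in_keys_iff lookup_scale_pm)

lemma subspace_keys: "pm.subspace {x. Poly_Mapping.keys x \<subseteq> S}"
  unfolding pm.subspace_def
  by (auto intro: subset_trans[OF keys_scale_pm, THEN subsetD] dest!: subsetD[OF keys_add])

lemma basis_in_keys: "t \<in> S \<Longrightarrow> basis t \<in> {x. Poly_Mapping.keys x \<subseteq> S}"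
  by simp

definition lin_ext :: "('k \<Rightarrow> 'b \<Rightarrow> 'b) \<Rightarrow> ('t \<Rightarrow> 'b) \<Rightarrow> ('t \<Rightarrow>\<^sub>0 'k :: field) \<Rightarrow> 'b :: ab_group_add" where
  "lin_ext s h x = (\<Sum>t\<in>Poly_Mapping.keys x. s (Poly_Mapping.lookup x t) (h t))"

context vector_space
begin

lemma lin_ext_superset:
  assumes "finite A" "Poly_Mapping.keys x \<subseteq> A"
  shows "lin_ext scale h x = (\<Sum>t\<in>A. scale (Poly_Mapping.lookup x t) (h t))"
  unfolding lin_ext_def using assms by (intro sum.mono_neutral_left) (auto simp: in_keys_iff)

lemma lin_ext_basis: "lin_ext scale h (basis t) = h t"
  by (simp add: lin_ext_def)

lemma linear_map_on_lin_ext: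
  fixes h :: "'t \<Rightarrow> 'b"
  assumes B: "subspace B" and h: "\<And>t. t \<in> S \<Longrightarrow> h t \<in> B"
  shows "linear_map_on scale_pm scale {x. Poly_Mapping.keys x \<subseteq> S} B (lin_ext scale h)"
proof (rule linear_map_onI)
  fix x :: "'t \<Rightarrow>\<^sub>0 'a" assume "x \<in> {x. Poly_Mapping.keys x \<subseteq> S}"
  thus "lin_ext scale h x \<in> B"
    unfolding lin_ext_def by (intro subspace_sum[OF B] subspace_scale[OF B]) (auto intro: h)
next
  fix x y :: "'t \<Rightarrow>\<^sub>0 'a"
  let ?A = "Poly_Mapping.keys x \<union> Poly_Mapping.keys y"
  have "lin_ext scale h (x + y) = (\<Sum>t\<in>?A. scale (Poly_Mapping.lookup (x + y) t) (h t))"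
    using keys_add[of x y] by (intro lin_ext_superset) auto
  also have "\<dots> = (\<Sum>t\<in>?A. scale (Poly_Mapping.lookup x t) (h t)) + (\<Sum>t\<in>?A. scale (Poly_Mapping.lookup y t) (h t))"
    by (simp add: lookup_add scale_left_distrib sum.distrib)
  also have "\<dots> = lin_ext scale h x + lin_ext scale h y"
    by (simp add: lin_ext_superset[of ?A])
  finally show "lin_ext scale h (x + y) = lin_ext scale h x + lin_ext scale h y" .
next
  fix c and x :: "'t \<Rightarrow>\<^sub>0 'a"
  have "lin_ext scale h (scale_pm c x) = (\<Sum>t\<in>Poly_Mapping.keys x. scale (Poly_Mapping.lookup (scale_pm c x) t) (h t))"
    by (rule lin_ext_superset[OF finite_keys keys_scale_pm])
  thus "lin_ext scale h (scale_pm c x) = scale c (lin_ext scale h x)"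
    by (simp add: lin_ext_def lookup_scale_pm scale_sum_right)
qed

text \<open>Since \<open>f\<close> is linear only on a subspace, the induction over the support also
  carries that the partial sums stay in that subspace.\<close>

lemma linear_map_on_eq_lin_ext:
  assumes f: "linear_map_on scale_pm scale {x. Poly_Mapping.keys x \<subseteq> S} B f"
    and x: "Poly_Mapping.keys x \<subseteq> S"
  shows "f x = lin_ext scale (\<lambda>t. f (basis t)) x"
proof -
  let ?V = "{x. Poly_Mapping.keys x \<subseteq> S}"
  have 0: "f 0 = 0" using linear_map_on_0[OF pm.vector_space_axioms vector_space_axioms f] by simp
  let ?\<Sigma> = "\<lambda>A. \<Sum>t\<in>A. scale_pm (Poly_Mapping.lookup x t) (basis t)"
  have *: "?\<Sigma> A \<in> ?V \<and> f (?\<Sigma> A) = (\<Sum>t\<in>A. scale (Poly_Mapping.lookup x t) (f (basis t)))"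
    if "finite A" "A \<subseteq> S" for A
    using that
  proof (induction A rule: finite_induct)
    case empty
    thus ?case using 0 by simp
  next
    case (insert t A)
    have t: "basis t \<in> ?V" using insert by simp
    have st: "scale_pm (Poly_Mapping.lookup x t) (basis t) \<in> ?V" by (rule pm.subspace_scale[OF subspace_keys t])
    have IH: "?\<Sigma> A \<in> ?V" "f (?\<Sigma> A) = (\<Sum>t\<in>A. scale (Poly_Mapping.lookup x t) (f (basis t)))"
      using insert by auto
    show ?case
      unfolding sum.insert[OF insert(1,2)] linear_map_onD(2)[OF f st IH(1)] linear_map_onD(3)[OF f t] IH(2)
      using pm.subspace_add[OF subspace_keys st IH(1)] by blast
  qed
  have "(\<Sum>t\<in>Poly_Mapping.keys x. scale_pm (Poly_Mapping.lookup x t) (basis t)) = x"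
    by (rule poly_mapping_eqI)
      (simp add: lookup_sum lookup_scale_pm lookup_single when_def sum.If_cases in_keys_iff)
  thus ?thesis using *[OF finite_keys x] by (simp add: lin_ext_def)
qed

end

text \<open>Two codomains \<open>B\<close> and \<open>C\<close> are allowed because the two sides of
  an operad axiom land in components whose arities are written differently.\<close>

lemma linear_map_on_eq:
  assumes "vector_space s" and f: "linear_map_on scale_pm s {x. Poly_Mapping.keys x \<subseteq> S} B f"
    and g: "linear_map_on scale_pm s {x. Poly_Mapping.keys x \<subseteq> S} C g"
    and eq: "\<And>t. t \<in> S \<Longrightarrow> f (basis t) = g (basis t)" and x: "Poly_Mapping.keys x \<subseteq> S"
  shows "f x = g x"
proof -
  interpret vector_space s by fact
  show ?thesis
    unfolding linear_map_on_eq_lin_ext[OF f x] linear_map_on_eq_lin_ext[OF g x] lin_ext_def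
    using eq x by (intro sum.cong) auto
qed

locale ns_set_operad =
  fixes X :: "nat \<Rightarrow> 't set" and e :: 't and op :: "nat \<Rightarrow> nat \<Rightarrow> nat \<Rightarrow> 't \<Rightarrow> 't \<Rightarrow> 't"
  assumes X_one: "X 1 = {e}"
    and op_closed: "1 \<le> i \<Longrightarrow> i \<le> n \<Longrightarrow> 1 \<le> m \<Longrightarrow> T \<in> X n \<Longrightarrow> S \<in> X m \<Longrightarrow> op n m i T S \<in> X (n + m - 1)"
    and op_sequential:
      "1 \<le> i \<Longrightarrow> i \<le> n \<Longrightarrow> 1 \<le> j \<Longrightarrow> j \<le> m \<Longrightarrow> 1 \<le> l \<Longrightarrow> T \<in> X n \<Longrightarrow> S \<in> X m \<Longrightarrow> R \<in> X l \<Longrightarrow>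
       op (n + m - 1) l (j + i - 1) (op n m i T S) R = op n (m + l - 1) i T (op m l j S R)"
    and op_parallel:
      "1 \<le> j \<Longrightarrow> j < i \<Longrightarrow> i \<le> n \<Longrightarrow> 1 \<le> m \<Longrightarrow> 1 \<le> l \<Longrightarrow> T \<in> X n \<Longrightarrow> S \<in> X m \<Longrightarrow> R \<in> X l \<Longrightarrow>
       op (n + m - 1) l j (op n m i T S) R = op (n + l - 1) m (i + l - 1) (op n l j T R) S"
    and op_one_left: "1 \<le> n \<Longrightarrow> T \<in> X n \<Longrightarrow> op 1 n 1 e T = T"
    and op_one_right: "1 \<le> i \<Longrightarrow> i \<le> n \<Longrightarrow> T \<in> X n \<Longrightarrow> op n 1 i T e = T"
begin

definition linearization :: "('k :: field, 't \<Rightarrow>\<^sub>0 'k) operad" where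
  "linearization = \<lparr>
     scl = scale_pm,
     comp = (\<lambda>n. {x. Poly_Mapping.keys x \<subseteq> X n}),
     one = basis e,
     circ = (\<lambda>n m i x y.
       \<Sum>T\<in>Poly_Mapping.keys x. \<Sum>S\<in>Poly_Mapping.keys y.
         Poly_Mapping.single (op n m i T S) (Poly_Mapping.lookup x T * Poly_Mapping.lookup y S))\<rparr>"

lemma linearization_simps:
  "scl linearization = scale_pm" "comp linearization n = {x. Poly_Mapping.keys x \<subseteq> X n}"
  "one linearization = basis e"
  by (simp_all add: linearization_def)

text \<open>The double sum can be iterated in either order. This version exhibits linearity in the
  left argument, the next one linearity in the right argument, both as instances of
  \<open>lin_ext\<close>.\<close>

lemma circ_linearization_left:
  "circ linearization n m i x y = lin_ext scale_pm (\<lambda>T. lin_ext scale_pm (\<lambda>S. basis (op n m i T S)) y) x"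
  by (simp add: linearization_def lin_ext_def pm.scale_sum_right scale_pm_single)

lemma circ_linearization_right:
  "circ linearization n m i x y = lin_ext scale_pm (\<lambda>S. lin_ext scale_pm (\<lambda>T. basis (op n m i T S)) x) y"
  by (simp add: linearization_def lin_ext_def pm.scale_sum_right scale_pm_single sum.swap[of _ "Poly_Mapping.keys y"] mult.commute)

lemma circ_linearization_basis: "circ linearization n m i (basis T) (basis S) = basis (op n m i T S)"
  by (simp add: circ_linearization_left pm.lin_ext_basis)

lemma circ_linearization_linear_left:
  assumes "1 \<le> i" "i \<le> n" "1 \<le> m" "Poly_Mapping.keys b \<subseteq> X m"
  shows "linear_map_on scale_pm scale_pm {x. Poly_Mapping.keys x \<subseteq> X n} {x. Poly_Mapping.keys x \<subseteq> X (n + m - 1)}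
    (\<lambda>a. circ linearization n m i a b)"
  unfolding circ_linearization_left
proof (rule pm.linear_map_on_lin_ext[OF subspace_keys])
  fix T assume T: "T \<in> X n"
  have "linear_map_on scale_pm scale_pm {x. Poly_Mapping.keys x \<subseteq> X m} {x. Poly_Mapping.keys x \<subseteq> X (n + m - 1)}
      (lin_ext scale_pm (\<lambda>S. basis (op n m i T S)))"
    by (rule pm.linear_map_on_lin_ext[OF subspace_keys basis_in_keys[OF op_closed[OF assms(1-3) T]]])
  thus "lin_ext scale_pm (\<lambda>S. basis (op n m i T S)) b \<in> {x. Poly_Mapping.keys x \<subseteq> X (n + m - 1)}"
    using linear_map_onD(1) assms(4) by blast
qed

lemma circ_linearization_linear_right:
  assumes "1 \<le> i" "i \<le> n" "1 \<le> m" "Poly_Mapping.keys a \<subseteq> X n"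
  shows "linear_map_on scale_pm scale_pm {x. Poly_Mapping.keys x \<subseteq> X m} {x. Poly_Mapping.keys x \<subseteq> X (n + m - 1)}
    (\<lambda>b. circ linearization n m i a b)"
  unfolding circ_linearization_right
proof (rule pm.linear_map_on_lin_ext[OF subspace_keys])
  fix S assume S: "S \<in> X m"
  have "linear_map_on scale_pm scale_pm {x. Poly_Mapping.keys x \<subseteq> X n} {x. Poly_Mapping.keys x \<subseteq> X (n + m - 1)}
      (lin_ext scale_pm (\<lambda>T. basis (op n m i T S)))"
    by (rule pm.linear_map_on_lin_ext[OF subspace_keys basis_in_keys[OF op_closed[OF assms(1-3) _ S]]])
  thus "lin_ext scale_pm (\<lambda>T. basis (op n m i T S)) a \<in> {x. Poly_Mapping.keys x \<subseteq> X (n + m - 1)}"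
    using linear_map_onD(1) assms(4) by blast
qed

lemma circ_linearization_closed:
  assumes "1 \<le> i" "i \<le> n" "1 \<le> m" "Poly_Mapping.keys a \<subseteq> X n" "Poly_Mapping.keys b \<subseteq> X m"
  shows "Poly_Mapping.keys (circ linearization n m i a b) \<subseteq> X (n + m - 1)"
  using linear_map_onD(1)[OF circ_linearization_linear_right[OF assms(1-4)]] assms(5) by blast

text \<open>Serves to check the sequential and parallel axioms on basis elements only:
  \<open>linear_map_on_eq\<close> is nested three times, freeing one argument each time.\<close>

lemma trilinear_eq:
  fixes F G :: "('t \<Rightarrow>\<^sub>0 'k :: field) \<Rightarrow> ('t \<Rightarrow>\<^sub>0 'k) \<Rightarrow> ('t \<Rightarrow>\<^sub>0 'k) \<Rightarrow> ('t \<Rightarrow>\<^sub>0 'k)"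
  assumes abc: "Poly_Mapping.keys a \<subseteq> A" "Poly_Mapping.keys b \<subseteq> B" "Poly_Mapping.keys c \<subseteq> C"
    and F1: "\<And>b c. Poly_Mapping.keys b \<subseteq> B \<Longrightarrow> Poly_Mapping.keys c \<subseteq> C \<Longrightarrow>
      linear_map_on scale_pm scale_pm {x. Poly_Mapping.keys x \<subseteq> A} V (\<lambda>a. F a b c)"
    and F2: "\<And>a c. Poly_Mapping.keys a \<subseteq> A \<Longrightarrow> Poly_Mapping.keys c \<subseteq> C \<Longrightarrow>
      linear_map_on scale_pm scale_pm {x. Poly_Mapping.keys x \<subseteq> B} V (\<lambda>b. F a b c)"
    and F3: "\<And>a b. Poly_Mapping.keys a \<subseteq> A \<Longrightarrow> Poly_Mapping.keys b \<subseteq> B \<Longrightarrow>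
      linear_map_on scale_pm scale_pm {x. Poly_Mapping.keys x \<subseteq> C} V (\<lambda>c. F a b c)"
    and G1: "\<And>b c. Poly_Mapping.keys b \<subseteq> B \<Longrightarrow> Poly_Mapping.keys c \<subseteq> C \<Longrightarrow>
      linear_map_on scale_pm scale_pm {x. Poly_Mapping.keys x \<subseteq> A} W (\<lambda>a. G a b c)"
    and G2: "\<And>a c. Poly_Mapping.keys a \<subseteq> A \<Longrightarrow> Poly_Mapping.keys c \<subseteq> C \<Longrightarrow>
      linear_map_on scale_pm scale_pm {x. Poly_Mapping.keys x \<subseteq> B} W (\<lambda>b. G a b c)"
    and G3: "\<And>a b. Poly_Mapping.keys a \<subseteq> A \<Longrightarrow> Poly_Mapping.keys b \<subseteq> B \<Longrightarrow>
      linear_map_on scale_pm scale_pm {x. Poly_Mapping.keys x \<subseteq> C} W (\<lambda>c. G a b c)"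
    and eq: "\<And>T S R. T \<in> A \<Longrightarrow> S \<in> B \<Longrightarrow> R \<in> C \<Longrightarrow> F (basis T) (basis S) (basis R) = G (basis T) (basis S) (basis R)"
  shows "F a b c = G a b c"
proof (rule linear_map_on_eq[OF pm.vector_space_axioms F1[OF abc(2,3)] G1[OF abc(2,3)] _ abc(1)])
  fix T assume T: "T \<in> A"
  hence kT: "Poly_Mapping.keys (basis T :: 't \<Rightarrow>\<^sub>0 'k) \<subseteq> A" by simp
  show "F (basis T) b c = G (basis T) b c"
  proof (rule linear_map_on_eq[OF pm.vector_space_axioms F2[OF kT abc(3)] G2[OF kT abc(3)] _ abc(2)])
    fix S assume S: "S \<in> B"
    hence kS: "Poly_Mapping.keys (basis S :: 't \<Rightarrow>\<^sub>0 'k) \<subseteq> B" by simp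
    show "F (basis T) (basis S) c = G (basis T) (basis S) c"
      by (rule linear_map_on_eq[OF pm.vector_space_axioms F3[OF kT kS] G3[OF kT kS] eq[OF T S] abc(3)])
  qed
qed

lemma ns_operad_linearization: "ns_operad (linearization :: ('k :: field, 't \<Rightarrow>\<^sub>0 'k) operad)"
proof -
  let ?L = "linearization :: ('k, 't \<Rightarrow>\<^sub>0 'k) operad"
  let ?K = "\<lambda>n. {x :: 't \<Rightarrow>\<^sub>0 'k. Poly_Mapping.keys x \<subseteq> X n}"
  note linL = circ_linearization_linear_left and linR = circ_linearization_linear_right
  show ?thesis
  proof (unfold_locales, unfold linearization_simps, goal_cases)
    case 1 show ?case by (rule pm.scale_right_distrib)
  next
    case 2 show ?case by (rule pm.scale_left_distrib)
  next
    case 3 show ?case by (rule pm.scale_scale)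
  next
    case 4 show ?case by (rule pm.scale_one)
  next
    case 5 show ?case by (rule subspace_keys)
  next
    case 6 show ?case by (metis lookup_single_eq lookup_zero zero_neq_one)
  next
    case 7
    have "x = scale_pm (Poly_Mapping.lookup x e) (basis e)" if "Poly_Mapping.keys x \<subseteq> {e}" for x :: "'t \<Rightarrow>\<^sub>0 'k"
      using that by (intro poly_mapping_eqI) (auto simp: lookup_scale_pm lookup_single when_def in_keys_iff)
    moreover have "Poly_Mapping.keys (scale_pm c (basis e)) \<subseteq> {e}" for c :: 'k
      using keys_scale_pm[of c "basis e"] by simp
    ultimately show ?case unfolding X_one by blast
  next
    case 8 thus ?case by (intro linL) auto
  next
    case 9 thus ?case by (intro linR) auto
  next
    case (10 i n j m l a b c)
    have k: "1 \<le> j + i - 1" "j + i - 1 \<le> n + m - 1" "1 \<le> m" "1 \<le> m + l - 1" "1 \<le> n + m - 1"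
      using 10(1-5) by auto
    show ?case
    proof (rule trilinear_eq[where A = "X n" and B = "X m" and C = "X l"
          and F = "\<lambda>a b c. circ ?L (n + m - 1) l (j + i - 1) (circ ?L n m i a b) c"
          and G = "\<lambda>a b c. circ ?L n (m + l - 1) i a (circ ?L m l j b c)"
          and V = "?K (n + m - 1 + l - 1)" and W = "?K (n + (m + l - 1) - 1)"], goal_cases)
      case 1 thus ?case using 10 by simp
    next
      case 2 thus ?case using 10 by simp
    next
      case 3 thus ?case using 10 by simp
    next
      case (4 b c)
      show ?case by (rule linear_map_on_compose[OF linL[OF 10(1,2) k(3) 4(1)] linL[OF k(1,2) 10(5) 4(2)]])
    next
      case (5 a c)
      show ?case by (rule linear_map_on_compose[OF linR[OF 10(1,2) k(3) 5(1)] linL[OF k(1,2) 10(5) 5(2)]])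
    next
      case (6 a b)
      show ?case by (rule linR[OF k(1,2) 10(5) circ_linearization_closed[OF 10(1,2) k(3) 6]])
    next
      case (7 b c)
      show ?case by (rule linL[OF 10(1,2) k(4) circ_linearization_closed[OF 10(3,4,5) 7]])
    next
      case (8 a c)
      show ?case by (rule linear_map_on_compose[OF linL[OF 10(3,4,5) 8(2)] linR[OF 10(1,2) k(4) 8(1)]])
    next
      case (9 a b)
      show ?case by (rule linear_map_on_compose[OF linR[OF 10(3,4,5) 9(2)] linR[OF 10(1,2) k(4) 9(1)]])
    next
      case (10 T S R)
      thus ?case using op_sequential[OF \<open>1 \<le> i\<close> \<open>i \<le> n\<close> \<open>1 \<le> j\<close> \<open>j \<le> m\<close> \<open>1 \<le> l\<close>] by (simp add: circ_linearization_basis)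
    qed
  next
    case (11 j i n m l a b c)
    have k: "1 \<le> i" "j \<le> n" "j \<le> n + m - 1" "1 \<le> i + l - 1" "i + l - 1 \<le> n + l - 1"
      using 11(1-5) by auto
    show ?case
    proof (rule trilinear_eq[where A = "X n" and B = "X m" and C = "X l"
          and F = "\<lambda>a b c. circ ?L (n + m - 1) l j (circ ?L n m i a b) c"
          and G = "\<lambda>a b c. circ ?L (n + l - 1) m (i + l - 1) (circ ?L n l j a c) b"
          and V = "?K (n + m - 1 + l - 1)" and W = "?K (n + l - 1 + m - 1)"], goal_cases)
      case 1 thus ?case using 11 by simp
    next
      case 2 thus ?case using 11 by simp
    next
      case 3 thus ?case using 11 by simp
    next
      case (4 b c)
      show ?case by (rule linear_map_on_compose[OF linL[OF k(1) 11(3,4) 4(1)] linL[OF 11(1) k(3) 11(5) 4(2)]])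
    next
      case (5 a c)
      show ?case by (rule linear_map_on_compose[OF linR[OF k(1) 11(3,4) 5(1)] linL[OF 11(1) k(3) 11(5) 5(2)]])
    next
      case (6 a b)
      show ?case by (rule linR[OF 11(1) k(3) 11(5) circ_linearization_closed[OF k(1) 11(3,4) 6]])
    next
      case (7 b c)
      show ?case by (rule linear_map_on_compose[OF linL[OF 11(1) k(2) 11(5) 7(2)] linL[OF k(4,5) 11(4) 7(1)]])
    next
      case (8 a c)
      show ?case by (rule linR[OF k(4,5) 11(4) circ_linearization_closed[OF 11(1) k(2) 11(5) 8]])
    next
      case (9 a b)
      show ?case by (rule linear_map_on_compose[OF linR[OF 11(1) k(2) 11(5) 9(1)] linL[OF k(4,5) 11(4) 9(2)]])
    next
      case (10 T S R)
      thus ?case using op_parallel[OF \<open>1 \<le> j\<close> \<open>j < i\<close> \<open>i \<le> n\<close> \<open>1 \<le> m\<close> \<open>1 \<le> l\<close>] by (simp add: circ_linearization_basis)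
    qed
  next
    case (12 n a)
    show ?case
    proof (rule linear_map_on_eq[OF pm.vector_space_axioms, where f = "\<lambda>a. circ ?L 1 n 1 (basis e) a" and g = "\<lambda>a. a"])
      show "linear_map_on scale_pm scale_pm (?K n) (?K (1 + n - 1)) (\<lambda>a. circ ?L 1 n 1 (basis e) a)"
        using 12 X_one by (intro linR) auto
      show "linear_map_on scale_pm scale_pm (?K n) (?K n) (\<lambda>a. a)" by (simp add: linear_map_on_def)
      show "circ ?L 1 n 1 (basis e) (basis T) = basis T" if "T \<in> X n" for T
        using op_one_left[OF 12(1) that] by (simp only: circ_linearization_basis)
      show "Poly_Mapping.keys a \<subseteq> X n" using 12 by simp
    qed
  next
    case (13 i n a)
    show ?case
    proof (rule linear_map_on_eq[OF pm.vector_space_axioms, where f = "\<lambda>a. circ ?L n 1 i a (basis e)" and g = "\<lambda>a. a"])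
      show "linear_map_on scale_pm scale_pm (?K n) (?K (n + 1 - 1)) (\<lambda>a. circ ?L n 1 i a (basis e))"
        using 13 X_one by (intro linL) auto
      show "linear_map_on scale_pm scale_pm (?K n) (?K n) (\<lambda>a. a)" by (simp add: linear_map_on_def)
      show "circ ?L n 1 i (basis T) (basis e) = basis T" if "T \<in> X n" for T
        using op_one_right[OF 13(1,2) that] by (simp only: circ_linearization_basis)
      show "Poly_Mapping.keys a \<subseteq> X n" using 13 by simp
    qed
  qed
qed

end

section \<open>Set operads with unique factorization\<close>

context ns_set_operad
begin

definition decomposable :: "nat \<Rightarrow> 't \<Rightarrow> bool" where
  "decomposable n T \<longleftrightarrow> (\<exists>p q i U S. 2 \<le> p \<and> 2 \<le> q \<and> n = p + q - 1 \<and> 1 \<le> i \<and> i \<le> p \<and>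
     U \<in> X p \<and> S \<in> X q \<and> T = op p q i U S)"

text \<open>The span of the indecomposable basis elements. It is chosen without reference to a test
  operad, so one family serves all types.\<close>

definition generators :: "nat \<Rightarrow> ('t \<Rightarrow>\<^sub>0 'k :: field) set" where
  "generators n = {x. Poly_Mapping.keys x \<subseteq> {T \<in> X n. \<not> decomposable n T}}"

text \<open>
  Two factorizations of one element, the second with its inner factor \<open>S'\<close> to the left of \<open>S\<close>,
  respectively with \<open>S\<close> nested in \<open>S'\<close>.
\<close>

definition disjoint_factors ::
  "nat \<Rightarrow> nat \<Rightarrow> nat \<Rightarrow> 't \<Rightarrow> 't \<Rightarrow> nat \<Rightarrow> nat \<Rightarrow> nat \<Rightarrow> 't \<Rightarrow> 't \<Rightarrow> bool" where
  "disjoint_factors n m i T S n' m' j T' S' \<longleftrightarrow>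
     (\<exists>w k W. 1 \<le> j \<and> j < k \<and> k \<le> w \<and> W \<in> X w \<and> n = w + m' - 1 \<and> n' = w + m - 1 \<and> i = k + m' - 1 \<and>
        T = op w m' j W S' \<and> T' = op w m k W S)"

definition nested_factors ::
  "nat \<Rightarrow> nat \<Rightarrow> nat \<Rightarrow> 't \<Rightarrow> 't \<Rightarrow> nat \<Rightarrow> nat \<Rightarrow> nat \<Rightarrow> 't \<Rightarrow> 't \<Rightarrow> bool" where
  "nested_factors n m i T S n' m' j T' S' \<longleftrightarrow>
     (\<exists>v k V. 2 \<le> v \<and> 1 \<le> k \<and> k \<le> v \<and> V \<in> X v \<and> n = n' + v - 1 \<and> m' = v + m - 1 \<and> i = k + j - 1 \<and>
        T = op n' v j T' V \<and> S' = op v m k V S)"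

text \<open>
  The values on basis elements of a morphism extending \<open>g\<close>, as a relation because an element may have
  several factorizations.
\<close>

inductive interp ::
  "('k :: field, 'b :: ab_group_add) operad \<Rightarrow> (nat \<Rightarrow> ('t \<Rightarrow>\<^sub>0 'k) \<Rightarrow> 'b) \<Rightarrow> nat \<Rightarrow> 't \<Rightarrow> 'b \<Rightarrow> bool"
  for Q g where
  unit: "interp Q g 1 e (one Q)"
| gen: "2 \<le> n \<Longrightarrow> T \<in> X n \<Longrightarrow> \<not> decomposable n T \<Longrightarrow> interp Q g n T (g n (basis T))"
| comp: "2 \<le> p \<Longrightarrow> 2 \<le> q \<Longrightarrow> 1 \<le> i \<Longrightarrow> i \<le> p \<Longrightarrow> U \<in> X p \<Longrightarrow> S \<in> X q \<Longrightarrow>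
    interp Q g p U u \<Longrightarrow> interp Q g q S s \<Longrightarrow> interp Q g (p + q - 1) (op p q i U S) (circ Q p q i u s)"

section \<open>Existence of values on basis elements\<close>

lemma interp_cases:
  assumes "interp Q g n T v"
  obtains "n = 1" "T = e" "v = one Q" | "2 \<le> n" "\<not> decomposable n T" "v = g n (basis T)"
  | p q i U S u s where "2 \<le> p" "2 \<le> q" "1 \<le> i" "i \<le> p" "U \<in> X p" "S \<in> X q" "interp Q g p U u" "interp Q g q S s"
    "n = p + q - 1" "T = op p q i U S" "v = circ Q p q i u s"
  using assms by cases blast+

lemma interp_exists: "1 \<le> n \<Longrightarrow> T \<in> X n \<Longrightarrow> \<exists>v. interp Q g n T v"
proof (induction n arbitrary: T rule: less_induct)
  case (less n)
  show ?case
  proof (cases "n = 1")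
    case True
    hence "T = e" using less.prems X_one by simp
    thus ?thesis unfolding True using unit by blast
  next
    case False
    hence n: "2 \<le> n" using less.prems by simp
    show ?thesis
    proof (cases "decomposable n T")
      case True
      then obtain p q i U S where d: "2 \<le> p" "2 \<le> q" "n = p + q - 1" "1 \<le> i" "i \<le> p"
          "U \<in> X p" "S \<in> X q" "T = op p q i U S"
        unfolding decomposable_def by blast
      have lt: "p < n" "1 \<le> p" "q < n" "1 \<le> q" using d(1-3) by auto
      obtain u where "interp Q g p U u" using less.IH[OF lt(1,2) d(6)] by blast
      moreover obtain s where "interp Q g q S s" using less.IH[OF lt(3,4) d(7)] by blast
      ultimately show ?thesis unfolding d(3,8) using comp[OF d(1,2,4,5,6,7)] by blast
    next
      case False
      thus ?thesis using gen[OF n less.prems(2)] by blast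
    qed
  qed
qed

lemma interp_in_comp:
  fixes Q :: "('k :: field, 'b :: ab_group_add) operad"
  assumes Q: "ns_operad Q" and g: "\<forall>n\<ge>2. linear_map_on scale_pm (scl Q) (generators n) (comp Q n) (g n)"
  shows "interp Q g n T v \<Longrightarrow> v \<in> comp Q n"
proof (induction rule: interp.induct)
  case unit show ?case using ns_operad.one_in_comp[OF Q] .
next
  case (gen n T)
  have "basis T \<in> generators n" using gen by (simp add: generators_def)
  thus ?case using linear_map_onD(1)[OF g[rule_format, OF gen(1)]] by blast
next
  case (comp p q i U S u s)
  thus ?case using ns_operad.circ_closed[OF Q] by simp
qed

end

text \<open>The added axiom is a local confluence condition: two factorizations either coincide or
  have a common refinement of one of the shapes occurring in the parallel and sequential
  axioms.\<close>

locale free_ns_set_operad = ns_set_operad X e op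
  for X :: "nat \<Rightarrow> 't set" and e :: 't and op :: "nat \<Rightarrow> nat \<Rightarrow> nat \<Rightarrow> 't \<Rightarrow> 't \<Rightarrow> 't" +
  assumes factorization:
    "2 \<le> n \<Longrightarrow> 2 \<le> m \<Longrightarrow> 2 \<le> n' \<Longrightarrow> 2 \<le> m' \<Longrightarrow> 1 \<le> i \<Longrightarrow> i \<le> n \<Longrightarrow> 1 \<le> j \<Longrightarrow> j \<le> n' \<Longrightarrow>
     T \<in> X n \<Longrightarrow> S \<in> X m \<Longrightarrow> T' \<in> X n' \<Longrightarrow> S' \<in> X m' \<Longrightarrow>
     n + m = n' + m' \<Longrightarrow> op n m i T S = op n' m' j T' S' \<Longrightarrow>
     n = n' \<and> m = m' \<and> i = j \<and> T = T' \<and> S = S' \<or>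
     disjoint_factors n m i T S n' m' j T' S' \<or> disjoint_factors n' m' j T' S' n m i T S \<or>
     nested_factors n m i T S n' m' j T' S' \<or> nested_factors n' m' j T' S' n m i T S"
begin

text \<open>Induction on arity. Two values that come from different factorizations are both
  expressed through the common refinement, where the operad axioms of \<open>Q\<close> make them
  equal.\<close>

lemma interp_unique:
  fixes Q :: "('k :: field, 'b :: ab_group_add) operad"
  assumes Q: "ns_operad Q" and g: "\<forall>n\<ge>2. linear_map_on scale_pm (scl Q) (generators n) (comp Q n) (g n)"
  shows "interp Q g n T v \<Longrightarrow> interp Q g n T v' \<Longrightarrow> v = v'"
proof (induction n arbitrary: T v v' rule: less_induct)
  case (less n)
  note in_comp = interp_in_comp[OF Q g]
  have disj: "circ Q p q i u s = circ Q p' q' j u' s'"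
    if D: "disjoint_factors p q i U S p' q' j U' S'" and n: "n = p + q - 1" "n = p' + q' - 1"
      and ge: "2 \<le> p" "2 \<le> q" "2 \<le> p'" "2 \<le> q'" and SX: "S \<in> X q" "S' \<in> X q'"
      and i: "interp Q g p U u" "interp Q g q S s" "interp Q g p' U' u'" "interp Q g q' S' s'"
    for p q i U S p' q' j U' S' u s u' s'
  proof -
    obtain w k W where W: "1 \<le> j" "j < k" "k \<le> w" "W \<in> X w" "p = w + q' - 1" "p' = w + q - 1" "i = k + q' - 1"
        "U = op w q' j W S'" "U' = op w q k W S"
      using D unfolding disjoint_factors_def by blast
    \<comment> \<open>The common outer part \<open>W\<close> has some value; the induction
      hypothesis then forces \<open>u\<close> and \<open>u'\<close> to be that value composed with
      \<open>s'\<close> and with \<open>s\<close>, and the claim becomes the parallel axiom.\<close>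
    obtain \<omega> where \<omega>: "interp Q g w W \<omega>" using interp_exists[OF _ W(4)] W(1-3) by force
    have b: "2 \<le> w" "j \<le> w" "1 \<le> k" "p < n" "p' < n" "1 \<le> q" "1 \<le> q'" using W(1-3) n ge by auto
    have u: "u = circ Q w q' j \<omega> s'"
      using less.IH[OF b(4) i(1)] comp[OF b(1) ge(4) W(1) b(2) W(4) SX(2) \<omega> i(4)] unfolding W(5,8) by blast
    have u': "u' = circ Q w q k \<omega> s"
      using less.IH[OF b(5) i(3)] comp[OF b(1) ge(2) b(3) W(3) W(4) SX(1) \<omega> i(2)] unfolding W(6,9) by blast
    show ?thesis unfolding u u' W(5,6,7)
      by (rule ns_operad.circ_parallel[OF Q W(1-3) b(6,7) in_comp[OF \<omega>] in_comp[OF i(2)] in_comp[OF i(4)], symmetric])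
  qed
  have nest: "circ Q p q i u s = circ Q p' q' j u' s'"
    if D: "nested_factors p q i U S p' q' j U' S'" and n: "n = p + q - 1" "n = p' + q' - 1"
      and ge: "2 \<le> p" "2 \<le> q" "2 \<le> p'" "2 \<le> q'" and j: "1 \<le> j" "j \<le> p'" and X: "S \<in> X q" "U' \<in> X p'"
      and i: "interp Q g p U u" "interp Q g q S s" "interp Q g p' U' u'" "interp Q g q' S' s'"
    for p q i U S p' q' j U' S' u s u' s'
  proof -
    obtain v k V where V: "2 \<le> v" "1 \<le> k" "k \<le> v" "V \<in> X v" "p = p' + v - 1" "q' = v + q - 1" "i = k + j - 1"
        "U = op p' v j U' V" "S' = op v q k V S"
      using D unfolding nested_factors_def by blast
    \<comment> \<open>Here the shared middle factor \<open>V\<close> is assigned to the outer tree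
      on one side and to the inner tree on the other, so the claim becomes the sequential
      axiom.\<close>
    obtain \<nu> where \<nu>: "interp Q g v V \<nu>" using interp_exists[OF _ V(4)] V(1) by force
    have b: "p < n" "q' < n" "1 \<le> q" using n ge by auto
    have u: "u = circ Q p' v j u' \<nu>"
      using less.IH[OF b(1) i(1)] comp[OF ge(3) V(1) j X(2) V(4) i(3) \<nu>] unfolding V(5,8) by blast
    have s': "s' = circ Q v q k \<nu> s"
      using less.IH[OF b(2) i(4)] comp[OF V(1) ge(2) V(2,3,4) X(1) \<nu> i(2)] unfolding V(6,9) by blast
    show ?thesis unfolding u s' V(5,6,7)
      by (rule ns_operad.circ_sequential[OF Q j V(2,3) b(3) in_comp[OF i(3)] in_comp[OF \<nu>] in_comp[OF i(2)]])
  qed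
  have comp_decomposable: "decomposable n T"
    if "2 \<le> p" "2 \<le> q" "1 \<le> i" "i \<le> p" "U \<in> X p" "S \<in> X q" "n = p + q - 1" "T = op p q i U S" for p q i U S
    using that unfolding decomposable_def by blast
  show ?case using less.prems(1)
  proof (cases rule: interp_cases)
    case 1
    show ?thesis using less.prems(2) by (cases rule: interp_cases) (use 1 in auto)
  next
    case 2
    show ?thesis using less.prems(2) by (cases rule: interp_cases) (use 2 comp_decomposable in auto)
  next
    case (3 p q i U S u s)
    note a = 3
    show ?thesis using less.prems(2)
    proof (cases rule: interp_cases)
      case 1
      thus ?thesis using a by auto
    next
      case 2
      thus ?thesis using a comp_decomposable by blast
    next
      case (3 p' q' j U' S' u' s')
      note b = 3
      have sum: "p + q = p' + q'" using a(1,2,9) b(1,2,9) by linarith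
      have lt: "p < n" "q < n" using a(1,2,9) by auto
      consider "p = p'" "q = q'" "i = j" "U = U'" "S = S'"
        | "disjoint_factors p q i U S p' q' j U' S'" | "disjoint_factors p' q' j U' S' p q i U S"
        | "nested_factors p q i U S p' q' j U' S'" | "nested_factors p' q' j U' S' p q i U S"
        using factorization[OF a(1,2) b(1,2) a(3,4) b(3,4) a(5,6) b(5,6) sum] a(10) b(10) by blast
      then show ?thesis
      proof cases
        case 1
        thus ?thesis using a(7,8,11) b(7,8,11) less.IH[OF lt(1)] less.IH[OF lt(2)] by blast
      next
        case 2
        show ?thesis unfolding a(11) b(11)
          by (rule disj[OF 2 a(9) b(9) a(1,2) b(1,2) a(6) b(6) a(7,8) b(7,8)])
      next
        case 3
        show ?thesis unfolding a(11) b(11)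
          by (rule disj[OF 3 b(9) a(9) b(1,2) a(1,2) b(6) a(6) b(7,8) a(7,8), symmetric])
      next
        case 4
        show ?thesis unfolding a(11) b(11)
          by (rule nest[OF 4 a(9) b(9) a(1,2) b(1,2) b(3,4) a(6) b(5) a(7,8) b(7,8)])
      next
        case 5
        show ?thesis unfolding a(11) b(11)
          by (rule nest[OF 5 b(9) a(9) b(1,2) a(1,2) a(3,4) b(6) a(5) b(7,8) a(7,8), symmetric])
      qed
    qed
  qed
qed

lemma extension_exists:
  fixes Q :: "('k :: field, 'b :: ab_group_add) operad"
  assumes Q: "ns_operad Q" and g: "\<forall>n\<ge>2. linear_map_on scale_pm (scl Q) (generators n) (comp Q n) (g n)"
  shows "\<exists>\<phi>. operad_morphism linearization Q \<phi> \<and> extends_family generators g \<phi>"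
proof -
  interpret Q: ns_operad Q by fact
  let ?L = "linearization :: ('k, 't \<Rightarrow>\<^sub>0 'k) operad"
  define h where "h n T = (THE v. interp Q g n T v)" for n T
  have h: "h n T = v" if "interp Q g n T v" for n T v
    unfolding h_def using that interp_unique[OF Q g] by (intro the_equality) blast+
  have interp_h: "interp Q g n T (h n T)" if n: "1 \<le> n" "T \<in> X n" for n T
  proof -
    obtain v where "interp Q g n T v" using interp_exists[OF n] by blast
    thus ?thesis using h by simp
  qed
  define \<phi> where "\<phi> n = lin_ext (scl Q) (h n)" for n
  have lin: "linear_map_on scale_pm (scl Q) {x. Poly_Mapping.keys x \<subseteq> X n} (comp Q n) (\<phi> n)" if n: "1 \<le> n" for n
    unfolding \<phi>_def
    by (rule Q.linear_map_on_lin_ext[OF Q.subspace_comp[OF n] interp_in_comp[OF Q g interp_h[OF n]]])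
  have \<phi>_basis: "\<phi> n (basis T) = h n T" for n T unfolding \<phi>_def by (rule Q.lin_ext_basis)
  have h_op: "h (n + m - 1) (op n m i T S) = circ Q n m i (h n T) (h m S)"
    if nm: "1 \<le> i" "i \<le> n" "1 \<le> m" and X: "T \<in> X n" "S \<in> X m" for n m i T S
  proof -
    have n: "1 \<le> n" using nm by simp
    have hT: "interp Q g n T (h n T)" and hS: "interp Q g m S (h m S)" using interp_h X nm n by auto
    \<comment> \<open>The rule \<open>interp.comp\<close> speaks only of factors of arity at least
      2; compositions with the unit come from the unit laws on both sides.\<close>
    consider "n = 1" | "m = 1" | "2 \<le> n" "2 \<le> m" using nm by linarith
    then show ?thesis
    proof cases
      case 1
      have e: "i = 1" "T = e" using 1 nm X X_one by auto
      have "h 1 e = one Q" by (rule h[OF unit])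
      thus ?thesis using 1 op_one_left[OF nm(3) X(2)] Q.circ_one_left[OF nm(3) interp_in_comp[OF Q g hS]]
        by (simp add: e)
    next
      case 2
      have e: "S = e" using 2 X X_one by auto
      have "h 1 e = one Q" by (rule h[OF unit])
      thus ?thesis using 2 op_one_right[OF nm(1,2) X(1)] Q.circ_one_right[OF nm(1,2) interp_in_comp[OF Q g hT]]
        by (simp add: e)
    next
      case 3
      show ?thesis by (rule h[OF comp[OF 3 nm(1,2) X hT hS]])
    qed
  qed
  have "operad_morphism ?L Q \<phi>"
  proof (rule operad_morphismI, unfold linearization_simps)
    show "linear_map_on scale_pm (scl Q) {x. Poly_Mapping.keys x \<subseteq> X n} (comp Q n) (\<phi> n)" if "1 \<le> n" for n
      by (rule lin[OF that])
    show "\<phi> 1 (basis e) = one Q" unfolding \<phi>_basis by (rule h[OF unit])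
  next
    fix n m i and a b :: "'t \<Rightarrow>\<^sub>0 'k"
    assume nm: "1 \<le> i" "i \<le> n" "1 \<le> m"
      and "a \<in> {x. Poly_Mapping.keys x \<subseteq> X n}" "b \<in> {x. Poly_Mapping.keys x \<subseteq> X m}"
    hence a: "Poly_Mapping.keys a \<subseteq> X n" and b: "Poly_Mapping.keys b \<subseteq> X m" by auto
    have n: "1 \<le> n" "1 \<le> n + m - 1" using nm by auto
    note vs = Q.vector_space_axioms
    show "\<phi> (n + m - 1) (circ ?L n m i a b) = circ Q n m i (\<phi> n a) (\<phi> m b)"
    \<comment> \<open>Both sides are bilinear, so \<open>a\<close> and then \<open>b\<close> may be
      replaced by basis elements, where \<open>h_op\<close> applies.\<close>
    proof (rule linear_map_on_eq[OF vs _ _ _ a])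
      show "linear_map_on scale_pm (scl Q) {x. Poly_Mapping.keys x \<subseteq> X n} (comp Q (n + m - 1))
          (\<lambda>a. \<phi> (n + m - 1) (circ ?L n m i a b))"
        by (rule linear_map_on_compose[OF circ_linearization_linear_left[OF nm b] lin[OF n(2)]])
      show "linear_map_on scale_pm (scl Q) {x. Poly_Mapping.keys x \<subseteq> X n} (comp Q (n + m - 1))
          (\<lambda>a. circ Q n m i (\<phi> n a) (\<phi> m b))"
        using linear_map_onD(1)[OF lin[OF nm(3)]] b
        by (intro linear_map_on_compose[OF lin[OF n(1)] Q.circ_linear_left[OF nm]]) blast
    next
      fix T assume T: "T \<in> X n"
      have hT: "h n T \<in> comp Q n" by (rule interp_in_comp[OF Q g interp_h[OF n(1) T]])
      have kT: "Poly_Mapping.keys (basis T :: 't \<Rightarrow>\<^sub>0 'k) \<subseteq> X n" using T by simp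
      show "\<phi> (n + m - 1) (circ ?L n m i (basis T) b) = circ Q n m i (\<phi> n (basis T)) (\<phi> m b)"
        unfolding \<phi>_basis
      proof (rule linear_map_on_eq[OF vs _ _ _ b])
        show "linear_map_on scale_pm (scl Q) {x. Poly_Mapping.keys x \<subseteq> X m} (comp Q (n + m - 1))
            (\<lambda>b. \<phi> (n + m - 1) (circ ?L n m i (basis T) b))"
          by (rule linear_map_on_compose[OF circ_linearization_linear_right[OF nm kT] lin[OF n(2)]])
        show "linear_map_on scale_pm (scl Q) {x. Poly_Mapping.keys x \<subseteq> X m} (comp Q (n + m - 1))
            (\<lambda>b. circ Q n m i (h n T) (\<phi> m b))"
          by (rule linear_map_on_compose[OF lin[OF nm(3)] Q.circ_linear_right[OF nm hT]])
        show "\<phi> (n + m - 1) (circ ?L n m i (basis T) (basis S)) = circ Q n m i (h n T) (\<phi> m (basis S))"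
          if S: "S \<in> X m" for S
          unfolding circ_linearization_basis \<phi>_basis by (rule h_op[OF nm T S])
      qed
    qed
  qed
  moreover have "extends_family generators g \<phi>"
    unfolding extends_family_def
  proof (intro allI impI ballI)
    fix n and x :: "'t \<Rightarrow>\<^sub>0 'k" assume n: "2 \<le> n" and x: "x \<in> generators n"
    let ?S = "{T \<in> X n. \<not> decomposable n T}"
    have k: "Poly_Mapping.keys x \<subseteq> ?S" using x by (simp add: generators_def)
    show "\<phi> n x = g n x"
    proof (rule linear_map_on_eq[OF Q.vector_space_axioms _ _ _ k])
      show "linear_map_on scale_pm (scl Q) {x. Poly_Mapping.keys x \<subseteq> ?S} (comp Q n) (\<phi> n)"
        using n linear_map_onD(1)[OF lin[of n]] by (intro linear_map_on_subset[OF lin]) auto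
      show "linear_map_on scale_pm (scl Q) {x. Poly_Mapping.keys x \<subseteq> ?S} (comp Q n) (g n)"
        using g n by (simp add: generators_def)
      show "\<phi> n (basis T) = g n (basis T)" if "T \<in> ?S" for T
        using h[OF gen[OF n, of T]] that \<phi>_basis by simp
    qed
  qed
  ultimately show ?thesis by blast
qed

text \<open>By induction on arity, each basis element is the unit, a generator or a composite of
  basis elements of smaller arity, so its image is forced.\<close>

lemma extension_unique:
  fixes Q :: "('k :: field, 'b :: ab_group_add) operad"
  assumes Q: "ns_operad Q"
    and \<phi>: "operad_morphism linearization Q \<phi>" "extends_family generators g \<phi>"
    and \<psi>: "operad_morphism linearization Q \<psi>" "extends_family generators g \<psi>"
    and n: "1 \<le> n" and x: "Poly_Mapping.keys x \<subseteq> X n"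
  shows "\<phi> n x = \<psi> n x"
proof -
  interpret Q: ns_operad Q by fact
  have basis_eq: "\<phi> n (basis T) = \<psi> n (basis T)" if "1 \<le> n" "T \<in> X n" for n T
    using that
  proof (induction n arbitrary: T rule: less_induct)
    case (less n)
    show ?case
    proof (cases "n = 1")
      case True
      hence "T = e" using less.prems X_one by auto
      thus ?thesis
        using operad_morphismD(2)[OF \<phi>(1)] operad_morphismD(2)[OF \<psi>(1)] True by (simp add: linearization_simps)
    next
      case False
      hence n: "2 \<le> n" using less.prems by simp
      show ?thesis
      proof (cases "decomposable n T")
        case True
        then obtain p q i U S where d: "2 \<le> p" "2 \<le> q" "n = p + q - 1" "1 \<le> i" "i \<le> p"
            "U \<in> X p" "S \<in> X q" "T = op p q i U S"
          unfolding decomposable_def by blast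
        have lt: "p < n" "1 \<le> p" "q < n" "1 \<le> q" using d(1-3) by auto
        have step: "\<omega> n (basis T) = circ Q p q i (\<omega> p (basis U)) (\<omega> q (basis S))"
          if "operad_morphism linearization Q \<omega>" for \<omega>
          using operad_morphismD(3)[OF that d(4,5), of q "basis U" "basis S"] d
          by (simp add: linearization_simps circ_linearization_basis)
        have "\<phi> p (basis U) = \<psi> p (basis U)" "\<phi> q (basis S) = \<psi> q (basis S)"
          using less.IH[OF lt(1,2) d(6)] less.IH[OF lt(3,4) d(7)] by auto
        thus ?thesis using step[OF \<phi>(1)] step[OF \<psi>(1)] by simp
      next
        case False
        hence "basis T \<in> generators n" using less.prems by (simp add: generators_def)
        thus ?thesis using \<phi>(2) \<psi>(2) n unfolding extends_family_def by metis
      qed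
    qed
  qed
  have lin: "linear_map_on scale_pm (scl Q) {x. Poly_Mapping.keys x \<subseteq> X n} (comp Q n) (\<omega> n)"
    if "operad_morphism linearization Q \<omega>" for \<omega>
    using operad_morphismD(1)[OF that n] by (simp add: linearization_simps)
  show ?thesis
    by (rule linear_map_on_eq[OF Q.vector_space_axioms lin[OF \<phi>(1)] lin[OF \<psi>(1)] basis_eq[OF n] x])
qed

lemma freely_generated_linearization:
  "freely_generated TYPE('b :: ab_group_add) (linearization :: ('k :: field, 't \<Rightarrow>\<^sub>0 'k) operad) generators"
proof -
  have "pm.subspace (generators n :: ('t \<Rightarrow>\<^sub>0 'k) set)" for n
    unfolding generators_def by (rule subspace_keys)
  moreover have "generators n \<subseteq> comp linearization n" for n
    by (auto simp: generators_def linearization_simps)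
  ultimately show ?thesis
    unfolding freely_generated_def linearization_simps(1)
    using extension_exists extension_unique by (simp add: linearization_simps(2)) blast
qed

text \<open>The family \<open>generators\<close> is universal both for the type of the carrier and
  for \<open>'b\<close>; \<open>freely_generated_transfer\<close> passes the latter on to every
  family that is universal for the carrier.\<close>

lemma free_operad_linearization:
  "free_operad TYPE('b :: ab_group_add) (linearization :: ('k :: field, 't \<Rightarrow>\<^sub>0 'k) operad)"
  unfolding free_operad_def
  using ns_operad_linearization freely_generated_linearization
    ns_operad.freely_generated_transfer[OF ns_operad_linearization freely_generated_linearization freely_generated_linearization]
  by blast

end

section \<open>Composition of parent functions\<close>

text \<open>
  A rooted tree is encoded by its parent function, which sends the root, as well as all numbers that
  are not vertices, to \<open>0\<close>. The last conjunct is acyclicity.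
\<close>

definition parent_tree :: "nat \<Rightarrow> (nat \<Rightarrow> nat) \<Rightarrow> bool" where
  "parent_tree n p \<longleftrightarrow>
     (\<forall>x. p x \<le> n) \<and> (\<forall>x. x \<notin> {1..n} \<longrightarrow> p x = 0) \<and>
     (\<exists>!x. x \<in> {1..n} \<and> p x = 0) \<and>
     (\<forall>A. A \<subseteq> {1..n} \<longrightarrow> A \<noteq> {} \<longrightarrow> (\<exists>x\<in>A. p x \<notin> A))"

lemma parent_le: "parent_tree n p \<Longrightarrow> p x \<le> n"
  and parent_outside: "parent_tree n p \<Longrightarrow> x \<notin> {1..n} \<Longrightarrow> p x = 0"
  and parent_root: "parent_tree n p \<Longrightarrow> \<exists>!x. x \<in> {1..n} \<and> p x = 0"
  and parent_exit: "parent_tree n p \<Longrightarrow> A \<subseteq> {1..n} \<Longrightarrow> A \<noteq> {} \<Longrightarrow> \<exists>x\<in>A. p x \<notin> A"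
  unfolding parent_tree_def by simp_all

lemma parent_neq: "parent_tree n p \<Longrightarrow> 1 \<le> i \<Longrightarrow> p i \<noteq> i"
  using parent_exit[of n p "{i}"] parent_outside[of n p i] by (cases "i \<le> n") auto

text \<open>Contraction of the block of inner labels to the vertex \<open>i\<close>, undoing
  \<open>relabel\<close> on the other vertices.\<close>

definition collapse :: "nat \<Rightarrow> nat \<Rightarrow> nat \<Rightarrow> nat" where
  "collapse i m x = (if x < i then x else if x < i + m then i else x + 1 - m)"

text \<open>In the block, the inner root inherits the parent of \<open>i\<close>. Outside it, a
  child of \<open>i\<close> is attached to the last label \<open>i + m - 1\<close> or the first
  label \<open>i\<close> of the block, which is \<open>f_Max\<close> shifted by
  \<open>i - 1\<close>. As \<open>relabel\<close> fixes 0 for positive \<open>i\<close>, the value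
  "no parent" survives.\<close>

definition pcomp :: "nat \<Rightarrow> nat \<Rightarrow> (nat \<Rightarrow> nat) \<Rightarrow> (nat \<Rightarrow> nat) \<Rightarrow> nat \<Rightarrow> nat" where
  "pcomp i m p q x =
     (if i \<le> x \<and> x < i + m
      then (if q (x + 1 - i) = 0 then relabel i m (p i) else q (x + 1 - i) + i - 1)
      else (if p (collapse i m x) = i then (if x < i then i + m - 1 else i)
            else relabel i m (p (collapse i m x))))"

lemma pcomp_in:
  "i \<le> x \<Longrightarrow> x < i + m \<Longrightarrow> pcomp i m p q x =
     (if q (x + 1 - i) = 0 then relabel i m (p i) else q (x + 1 - i) + i - 1)"
  by (simp add: pcomp_def)

lemma pcomp_out:
  "\<not> (i \<le> x \<and> x < i + m) \<Longrightarrow> pcomp i m p q x =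
     (if p (collapse i m x) = i then (if x < i then i + m - 1 else i)
      else relabel i m (p (collapse i m x)))"
  unfolding pcomp_def by presburger

lemma relabel_eq_0_iff: "1 \<le> i \<Longrightarrow> 1 \<le> m \<Longrightarrow> relabel i m y = 0 \<longleftrightarrow> y = 0"
  by (auto simp: relabel_def)

lemma collapse_relabel: "1 \<le> m \<Longrightarrow> y \<noteq> i \<Longrightarrow> collapse i m (relabel i m y) = y"
  by (auto simp: collapse_def relabel_def)

lemma relabel_collapse: "1 \<le> m \<Longrightarrow> \<not> (i \<le> x \<and> x < i + m) \<Longrightarrow> relabel i m (collapse i m x) = x"
  by (auto simp: collapse_def relabel_def)

lemma relabel_outside: "1 \<le> m \<Longrightarrow> y \<noteq> i \<Longrightarrow> \<not> (i \<le> relabel i m y \<and> relabel i m y < i + m)"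
  by (auto simp: relabel_def)

lemma collapse_eq_iff: "collapse i m x = i \<longleftrightarrow> i \<le> x \<and> x < i + m" if "1 \<le> m"
  using that by (auto simp: collapse_def)

lemma collapse_bounds: "collapse i m x \<in> {1..n} \<longleftrightarrow> x \<in> {1..n + m - 1}"
  if "1 \<le> m" "1 \<le> i" "i \<le> n"
  using that by (auto simp: collapse_def)

text \<open>Both possible attachment points of an entering edge collapse to \<open>i\<close>, so
  outside the block \<open>collapse\<close> intertwines the composite with the outer parent
  function.\<close>

lemma pcomp_collapse_out:
  assumes "1 \<le> m" "\<not> (i \<le> x \<and> x < i + m)"
  shows "collapse i m (pcomp i m p q x) = p (collapse i m x)"
  using assms by (auto simp: pcomp_def collapse_relabel, auto simp: collapse_def)

text \<open>Acyclicity is tested first on the contracted image of a set of vertices and, if the exit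
  found there is the contracted vertex, once more inside the inner tree.\<close>

lemma parent_tree_pcomp:
  assumes p: "parent_tree n p" and q: "parent_tree m q" and i: "1 \<le> i" "i \<le> n"
  shows "parent_tree (n + m - 1) (pcomp i m p q)"
proof -
  obtain r where r: "r \<in> {1..n}" "p r = 0" and ru: "\<And>x. x \<in> {1..n} \<Longrightarrow> p x = 0 \<Longrightarrow> x = r"
    using parent_root[OF p] by blast
  obtain s where s: "s \<in> {1..m}" "q s = 0" and su: "\<And>x. x \<in> {1..m} \<Longrightarrow> q x = 0 \<Longrightarrow> x = s"
    using parent_root[OF q] by blast
  have m: "1 \<le> m" using s by auto
  let ?P = "pcomp i m p q" and ?N = "n + m - 1"
  have ple: "\<And>x. p x \<le> n" and qle: "\<And>x. q x \<le> m" using parent_le p q by auto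
  have p0: "\<And>x. x \<notin> {1..n} \<Longrightarrow> p x = 0" using parent_outside p by auto
  have pi: "p i \<noteq> i" using parent_neq[OF p] i by auto
  have a: "?P x \<le> ?N" for x
  proof -
    have "relabel i m (p y) \<le> ?N" for y using ple[of y] m by (auto simp: relabel_def)
    moreover have "q y + i - 1 \<le> ?N" for y using qle[of y] m i by auto
    ultimately show ?thesis using i m by (auto simp: pcomp_def)
  qed
  have b: "?P x = 0" if "x \<notin> {1..?N}" for x
  proof -
    have c: "collapse i m x \<notin> {1..n}" using that collapse_bounds m i by blast
    have "\<not> (i \<le> x \<and> x < i + m)" using that i by auto
    with p0[OF c] i show ?thesis by (auto simp: pcomp_def relabel_def)
  qed
  have root: "x = (if r = i then s + i - 1 else relabel i m r)" if x: "x \<in> {1..?N}" "?P x = 0" for x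
  proof (cases "i \<le> x \<and> x < i + m")
    case True
    have qz: "q (x + 1 - i) = 0" "p i = 0"
      using x(2) True i m by (auto simp: pcomp_in relabel_eq_0_iff split: if_splits)
    from qz(1) have "x + 1 - i = s" using True by (intro su) auto
    moreover have "i = r" using ru i qz by auto
    ultimately show ?thesis using True by auto
  next
    case False
    have "p (collapse i m x) = 0" using x(2) i m
      by (auto simp: pcomp_out[OF False] relabel_eq_0_iff split: if_splits)
    hence "collapse i m x = r" using ru collapse_bounds[of m i n x] x i m by auto
    thus ?thesis using False relabel_collapse[of m i x] m collapse_eq_iff[of m i x] by auto
  qed
  have ex: "\<exists>!x. x \<in> {1..?N} \<and> ?P x = 0"
  proof (cases "r = i")
    case True
    have "?P (s + i - 1) = 0" using True r s i m by (auto simp: pcomp_in relabel_eq_0_iff)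
    moreover have "s + i - 1 \<in> {1..?N}" using s i by auto
    ultimately show ?thesis using root unfolding if_P[OF True] by (intro ex1I[of _ "s + i - 1"] conjI) blast+
  next
    case False
    have "?P (relabel i m r) = 0"
      unfolding pcomp_out[OF relabel_outside[OF m False]] collapse_relabel[OF m False]
      using i r m by (simp add: relabel_eq_0_iff)
    moreover have "relabel i m r \<in> {1..?N}" using r m by (auto simp: relabel_def)
    ultimately show ?thesis using root unfolding if_not_P[OF False] by (intro ex1I[of _ "relabel i m r"] conjI) blast+
  qed
  have acyc: "\<exists>x\<in>A. ?P x \<notin> A" if A: "A \<subseteq> {1..?N}" "A \<noteq> {}" for A
  proof -
    have "collapse i m ` A \<subseteq> {1..n}" using A collapse_bounds[of m i n] m i by blast
    then obtain y where y: "y \<in> collapse i m ` A" "p y \<notin> collapse i m ` A"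
      using parent_exit[OF p] A by (metis image_is_empty)
    then obtain x where x: "x \<in> A" "y = collapse i m x" by auto
    show ?thesis
    proof (cases "i \<le> x \<and> x < i + m")
      case False
      have "?P x \<notin> A" using pcomp_collapse_out[OF m False, of p q] x y by (metis imageI)
      thus ?thesis using x by auto
    next
      case True
      hence yi: "y = i" using x m by (simp add: collapse_eq_iff)
      \<comment> \<open>The inner vertices lying in \<open>A\<close>. An exit \<open>z\<close> of
        this set either has its inner parent outside \<open>A\<close>, or is the inner root, whose
        parent collapses to \<open>p i\<close> and so is outside \<open>A\<close> by the choice of
        \<open>y\<close>.\<close>
      let ?B = "{z \<in> {1..m}. z + i - 1 \<in> A}"
      have "x + 1 - i \<in> ?B" using True x i by auto
      then obtain z where z: "z \<in> ?B" "q z \<notin> ?B" using parent_exit[OF q, of ?B] by blast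
      have "?P (z + i - 1) \<notin> A"
      proof (cases "q z = 0")
        case qz: True
        have "?P (z + i - 1) = relabel i m (p i)" using qz z i by (auto simp: pcomp_def)
        hence "collapse i m (?P (z + i - 1)) = p i" using collapse_relabel m pi by auto
        thus ?thesis using y yi by (metis imageI)
      next
        case False
        have "?P (z + i - 1) = q z + i - 1" using False z i by (auto simp: pcomp_def)
        thus ?thesis using z qle[of z] False by auto
      qed
      thus ?thesis using z by blast
    qed
  qed
  show ?thesis unfolding parent_tree_def using a b ex acyc by blast
qed

section \<open>Associativity of the composition of parent functions\<close>

lemma relabel_Suc: "relabel (Suc i) (Suc m) y = (if y \<le> i then y else y + m)"
  by (auto simp: relabel_def)

text \<open>Writing the position and the block length as successors, and the argument as a shifted
  label \<open>y\<close> in the next two rules, removes the truncated subtractions. The three rules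
  cover the labels below, in and above the block.\<close>

lemma pcomp_low: "x \<le> i \<Longrightarrow> pcomp (Suc i) (Suc m) p q x =
   (if p x = Suc i then Suc (i + m) else relabel (Suc i) (Suc m) (p x))"
  by (simp add: pcomp_def collapse_def)

lemma pcomp_mid: "x = y + i \<Longrightarrow> 1 \<le> y \<Longrightarrow> y \<le> Suc m \<Longrightarrow> pcomp (Suc i) (Suc m) p q x =
   (if q y = 0 then relabel (Suc i) (Suc m) (p (Suc i)) else q y + i)"
  by (simp add: pcomp_def)

lemma pcomp_high: "x = y + m \<Longrightarrow> Suc i < y \<Longrightarrow> pcomp (Suc i) (Suc m) p q x =
   (if p y = Suc i then Suc i else relabel (Suc i) (Suc m) (p y))"
  by (auto simp add: pcomp_def collapse_def)

text \<open>The delicate edges are those entering the larger block when its first or last vertex is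
  the one being substituted (\<open>j = 1\<close> or \<open>j = m\<close>): the first or last label
  of the smaller block is then also that of the larger one, so both sides attach the edge
  alike.\<close>

lemma pcomp_sequential:
  assumes p: "parent_tree n p" and q: "parent_tree m q" and r: "parent_tree l r"
    and ij: "1 \<le> i" "i \<le> n" "1 \<le> j" "j \<le> m" "1 \<le> l"
  shows "pcomp (j + i - 1) l (pcomp i m p q) r = pcomp i (m + l - 1) p (pcomp j l q r)"
proof
  fix x
  obtain i' j' m' l' where S: "i = Suc i'" "j = Suc j'" "m = Suc m'" "l = Suc l'" and jm: "j' \<le> m'"
    using ij by (cases i; cases j; cases m; cases l) auto
  have J: "Suc j' + Suc i' - 1 = Suc (j' + i')" "Suc m' + Suc l' - 1 = Suc (m' + l')" by auto
  have ne: "p (Suc i') \<noteq> Suc i'" "q (Suc j') \<noteq> Suc j'"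
    using parent_neq[OF p, of i] parent_neq[OF q, of j] ij S by auto
  have qle: "\<And>x. q x \<le> Suc m'" and rle: "\<And>x. r x \<le> Suc l'" using parent_le q r S by auto
  let ?A = "pcomp (Suc i') (Suc m') p q" and ?B = "pcomp (Suc j') (Suc l') q r"
    and ?J = "j' + i'" and ?M = "m' + l'"
  \<comment> \<open>The ranges are: before the larger block, in it before the smaller block, in the
    smaller block, in the larger block after it, and after both. The variable \<open>y\<close> is
    the label of \<open>x\<close> in the tree that it comes from.\<close>
  consider (1) "x \<le> i'" | (2) y where "x = y + i'" "1 \<le> y" "y \<le> j'"
    | (3) y where "x = y + (j' + i')" "1 \<le> y" "y \<le> Suc l'"
    | (4) y where "x = y + i' + l'" "Suc j' < y" "y \<le> Suc m'" 
    | (5) y where "x = y + m' + l'" "Suc i' < y" 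
  proof -
    have "x \<le> i' \<or> (i' < x \<and> x \<le> ?J) \<or> (?J < x \<and> x \<le> Suc ?J + l') \<or>
       (Suc ?J + l' < x \<and> x \<le> Suc i' + m' + l') \<or> Suc i' + m' + l' < x" by linarith
    thus thesis
    proof (elim disjE)
      assume "x \<le> i'" thus thesis by (rule 1)
    next
      assume "i' < x \<and> x \<le> ?J" thus thesis by (intro 2[of "x - i'"]) auto
    next
      assume "?J < x \<and> x \<le> Suc ?J + l'" thus thesis by (intro 3[of "x - ?J"]) auto
    next
      assume "Suc ?J + l' < x \<and> x \<le> Suc i' + m' + l'" thus thesis by (intro 4[of "x - i' - l'"]) auto
    next
      assume "Suc i' + m' + l' < x" thus thesis by (intro 5[of "x - m' - l'"]) auto
    qed
  qed
  then have "pcomp (Suc ?J) (Suc l') ?A r x = pcomp (Suc i') (Suc ?M) p ?B x"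
  proof cases
    case 1
    have *: "x \<le> ?J" using 1 by auto
    show ?thesis unfolding pcomp_low[OF 1] pcomp_low[OF *] relabel_Suc
      using jm by simp
  next
    case (2 y)
    have y: "y \<le> Suc m'" "y \<le> Suc ?M" "x \<le> ?J" using 2 jm by auto
    show ?thesis
      unfolding pcomp_low[OF y(3)] pcomp_mid[OF 2(1,2) y(1)] pcomp_mid[OF 2(1,2) y(2)]
        pcomp_low[OF 2(3)] relabel_Suc
      using jm ne qle[of y] by simp
  next
    case (3 y)
    have u: "x = (y + j') + i'" "1 \<le> y + j'" "y + j' \<le> Suc ?M" using 3 jm by auto
    have J: "Suc ?J = Suc j' + i'" "1 \<le> Suc j'" "Suc j' \<le> Suc m'" using jm by auto
    show ?thesis
      unfolding pcomp_mid[OF 3] pcomp_mid[OF u] pcomp_mid[OF refl 3(2,3)] pcomp_mid[OF J] relabel_Suc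
      using jm ne qle[of "Suc j'"] rle[of y] by simp
  next
    case (4 y)
    have u: "Suc ?J < y + i'" "1 \<le> y" 
      and v: "x = y + l' + i'" "1 \<le> y + l'" "y + l' \<le> Suc ?M" using 4 jm by auto
    show ?thesis
      unfolding pcomp_high[OF 4(1) u(1)] pcomp_mid[OF refl u(2) 4(3)] pcomp_mid[OF v]
        pcomp_high[OF refl 4(2)] relabel_Suc
      using jm ne qle[of y] by simp
  next
    case (5 y)
    have u: "Suc ?J < y + m'" "x = y + ?M" using 5 jm by auto
    show ?thesis
      unfolding pcomp_high[OF 5(1) u(1)] pcomp_high[OF refl 5(2)] pcomp_high[OF u(2) 5(2)] relabel_Suc
      using jm by simp
  qed
  then show "pcomp (j + i - 1) l (pcomp i m p q) r x = pcomp i (m + l - 1) p (pcomp j l q r) x"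
    unfolding S J .
qed

lemma pcomp_parallel:
  assumes p: "parent_tree n p" and q: "parent_tree m q" and r: "parent_tree l r"
    and ij: "1 \<le> j" "j < i" "i \<le> n" "1 \<le> m" "1 \<le> l"
  shows "pcomp j l (pcomp i m p q) r = pcomp (i + l - 1) m (pcomp j l p r) q"
proof
  fix x
  obtain i' j' m' l' where S: "i = Suc i'" "j = Suc j'" "m = Suc m'" "l = Suc l'" and jm: "j' < i'"
    using ij by (cases i; cases j; cases m; cases l) auto
  have J: "Suc i' + Suc l' - 1 = Suc (i' + l')" by auto
  have ne: "p (Suc i') \<noteq> Suc i'" "p (Suc j') \<noteq> Suc j'"
    using parent_neq[OF p, of i] parent_neq[OF p, of j] ij S by auto
  have qle: "\<And>x. q x \<le> Suc m'" and rle: "\<And>x. r x \<le> Suc l'" using parent_le q r S by auto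
  \<comment> \<open>The five ranges are the two disjoint blocks and the three stretches before,
    between and after them; \<open>y\<close> is again the original label.\<close>
  consider (1) "x \<le> j'" | (2) y where "x = y + j'" "1 \<le> y" "y \<le> Suc l'"
    | (3) y where "x = y + l'" "Suc j' < y" "y \<le> i'" 
    | (4) y where "x = y + (i' + l')" "1 \<le> y" "y \<le> Suc m'" 
    | (5) y where "x = y + m' + l'" "Suc i' < y" 
  proof -
    have "x \<le> j' \<or> (j' < x \<and> x \<le> Suc j' + l') \<or> (Suc j' + l' < x \<and> x \<le> i' + l') \<or>
       (i' + l' < x \<and> x \<le> Suc i' + m' + l') \<or> Suc i' + m' + l' < x" by linarith
    thus thesis
    proof (elim disjE)
      assume "x \<le> j'" thus thesis by (rule 1)
    next
      assume "j' < x \<and> x \<le> Suc j' + l'" thus thesis by (intro 2[of "x - j'"]) auto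
    next
      assume "Suc j' + l' < x \<and> x \<le> i' + l'" thus thesis by (intro 3[of "x - l'"]) auto
    next
      assume "i' + l' < x \<and> x \<le> Suc i' + m' + l'" thus thesis by (intro 4[of "x - (i' + l')"]) auto
    next
      assume "Suc i' + m' + l' < x" thus thesis by (intro 5[of "x - m' - l'"]) auto
    qed
  qed
  then have "pcomp (Suc j') (Suc l') (pcomp (Suc i') (Suc m') p q) r x =
      pcomp (Suc (i' + l')) (Suc m') (pcomp (Suc j') (Suc l') p r) q x"
  proof cases
    case 1
    have *: "x \<le> i'" "x \<le> i' + l'" using 1 jm by auto
    show ?thesis unfolding pcomp_low[OF 1] pcomp_low[OF *(1)] pcomp_low[OF *(2)] relabel_Suc
      using jm by simp
  next
    case (2 y)
    have u: "x \<le> i' + l'" "Suc j' \<le> i'" using 2 jm by auto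
    show ?thesis unfolding pcomp_low[OF u(1)] pcomp_mid[OF 2] pcomp_low[OF u(2)] relabel_Suc
      using jm ne rle[of y] by simp
  next
    case (3 y)
    have u: "x \<le> i' + l'" using 3 by auto
    show ?thesis unfolding pcomp_low[OF u] pcomp_high[OF 3(1,2)] pcomp_low[OF 3(3)] relabel_Suc
      using jm by simp
  next
    case (4 y)
    have u: "x = y + i' + l'" "Suc j' < y + i'" "Suc (i' + l') = Suc i' + l'" "Suc j' < Suc i'"
      using 4 jm by auto
    show ?thesis
      unfolding pcomp_high[OF u(1,2)] pcomp_mid[OF refl 4(2,3)] pcomp_mid[OF 4] pcomp_high[OF u(3,4)] relabel_Suc
      using jm ne qle[of y] by simp
  next
    case (5 y)
    have u: "Suc j' < y + m'" "x = y + l' + m'" "Suc (i' + l') < y + l'" "Suc j' < y" using 5 jm by auto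
    show ?thesis
      unfolding pcomp_high[OF 5(1) u(1)] pcomp_high[OF refl 5(2)] pcomp_high[OF u(2,3)]
        pcomp_high[OF refl u(4)] relabel_Suc
      using jm by simp
  qed
  then show "pcomp j l (pcomp i m p q) r x = pcomp (i + l - 1) m (pcomp j l p r) q x"
    unfolding S J .
qed

section \<open>Blocks of a tree\<close>

lemma parent_tree_1_iff: "parent_tree 1 p \<longleftrightarrow> p = (\<lambda>x. 0)"
proof
  assume p: "parent_tree 1 p"
  have "p x = 0" for x
    using parent_le[OF p, of x] parent_neq[OF p, of 1] parent_outside[OF p, of x]
    by (cases "x = 1") auto
  thus "p = (\<lambda>x. 0)" by auto
next
  assume "p = (\<lambda>x. 0)"
  thus "parent_tree 1 p" unfolding parent_tree_def by (auto simp: subset_iff)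
qed

lemma pcomp_unit_left: "parent_tree n q \<Longrightarrow> pcomp 1 n (\<lambda>x. 0) q = q"
proof
  fix x assume q: "parent_tree n q"
  show "pcomp 1 n (\<lambda>x. 0) q x = q x"
    using parent_outside[OF q, of x] by (cases "x \<in> {1..n}") (auto simp: pcomp_def relabel_def)
qed

lemma pcomp_unit_right: "1 \<le> i \<Longrightarrow> pcomp i 1 p (\<lambda>x. 0) = p"
  by (auto simp: pcomp_def relabel_def collapse_def fun_eq_iff less_Suc_eq)

text \<open>The labels of the inner tree of a composition form such a block, and conversely.\<close>

definition good_block :: "nat \<Rightarrow> nat \<Rightarrow> (nat \<Rightarrow> nat) \<Rightarrow> bool" where
  "good_block i m p \<longleftrightarrow>
     (\<exists>!x. x \<in> {i..<i + m} \<and> p x \<notin> {i..<i + m}) \<and>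
     (\<forall>x. x \<notin> {i..<i + m} \<longrightarrow> p x \<in> {i..<i + m} \<longrightarrow> p x = (if x < i then i + m - 1 else i))"

lemma good_blockI:
  assumes "x \<in> {i..<i + m}" "p x \<notin> {i..<i + m}"
    and "\<And>y. y \<in> {i..<i + m} \<Longrightarrow> p y \<notin> {i..<i + m} \<Longrightarrow> y = x"
    and "\<And>y. y \<notin> {i..<i + m} \<Longrightarrow> p y \<in> {i..<i + m} \<Longrightarrow> p y = (if y < i then i + m - 1 else i)"
  shows "good_block i m p"
  unfolding good_block_def using assms by blast

lemma good_block_exit:
  assumes "good_block i m p"
  obtains x where "x \<in> {i..<i + m}" "p x \<notin> {i..<i + m}"
    "\<And>y. y \<in> {i..<i + m} \<Longrightarrow> p y \<notin> {i..<i + m} \<Longrightarrow> y = x"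
  using assms unfolding good_block_def by blast

lemma good_block_enter:
  "good_block i m p \<Longrightarrow> y \<notin> {i..<i + m} \<Longrightarrow> p y \<in> {i..<i + m} \<Longrightarrow> p y = (if y < i then i + m - 1 else i)"
  unfolding good_block_def by blast

text \<open>Reading rules for a composite: the inner root is the block vertex whose parent leaves
  the block, and that parent collapses to the parent of \<open>i\<close> in the outer tree.\<close>

lemma pcomp_in_iff:
  assumes p: "parent_tree n p" and q: "parent_tree m q" and i: "1 \<le> i" and y: "1 \<le> y" "y \<le> m"
  shows "pcomp i m p q (y + i - 1) \<in> {i..<i + m} \<longleftrightarrow> q y \<noteq> 0"
    and "q y \<noteq> 0 \<Longrightarrow> pcomp i m p q (y + i - 1) = q y + i - 1"
    and "q y = 0 \<Longrightarrow> collapse i m (pcomp i m p q (y + i - 1)) = p i"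
proof -
  have m: "1 \<le> m" using y by auto
  have e: "pcomp i m p q (y + i - 1) = (if q y = 0 then relabel i m (p i) else q y + i - 1)"
    using pcomp_in[of i "y + i - 1" m p q] y i by simp
  note ne = parent_neq[OF p i]
  show "q y \<noteq> 0 \<Longrightarrow> pcomp i m p q (y + i - 1) = q y + i - 1"
    and "q y = 0 \<Longrightarrow> collapse i m (pcomp i m p q (y + i - 1)) = p i"
    unfolding e using collapse_relabel[OF m ne] by auto
  show "pcomp i m p q (y + i - 1) \<in> {i..<i + m} \<longleftrightarrow> q y \<noteq> 0"
    unfolding e using relabel_outside[OF m ne] parent_le[OF q, of y] i by auto
qed

lemma good_block_pcomp:
  assumes p: "parent_tree n p" and q: "parent_tree m q" and i: "1 \<le> i"
  shows "good_block i m (pcomp i m p q)"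
proof -
  obtain s where s: "s \<in> {1..m}" "q s = 0" and su: "\<And>x. x \<in> {1..m} \<Longrightarrow> q x = 0 \<Longrightarrow> x = s"
    using parent_root[OF q] by blast
  have m: "1 \<le> m" using s by auto
  show ?thesis
  proof (rule good_blockI[of "s + i - 1"])
    show "s + i - 1 \<in> {i..<i + m}" using s i by auto
    show "pcomp i m p q (s + i - 1) \<notin> {i..<i + m}" using pcomp_in_iff(1)[OF p q i] s by auto
  next
    fix y assume y: "y \<in> {i..<i + m}" "pcomp i m p q y \<notin> {i..<i + m}"
    have "1 \<le> y + 1 - i" "y + 1 - i \<le> m" "y + 1 - i + i - 1 = y" using y i by auto
    hence "q (y + 1 - i) = 0" using pcomp_in_iff(1)[OF p q i, of "y + 1 - i"] y by auto
    hence "y + 1 - i = s" using y i by (intro su) auto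
    thus "y = s + i - 1" using y by auto
  next
    fix y assume y: "y \<notin> {i..<i + m}" "pcomp i m p q y \<in> {i..<i + m}"
    have o: "\<not> (i \<le> y \<and> y < i + m)" using y by auto
    show "pcomp i m p q y = (if y < i then i + m - 1 else i)"
      using y(2) relabel_outside[OF m, of "p (collapse i m y)" i] unfolding pcomp_out[OF o]
      by (auto split: if_splits)
  qed
qed

text \<open>With position and length of the block fixed, \<open>q\<close> is read off inside the
  block, \<open>p i\<close> from the parent of the inner root, and the remaining values of
  \<open>p\<close> through \<open>collapse\<close>.\<close>

lemma pcomp_inject:
  assumes p: "parent_tree n p" and q: "parent_tree m q" 
    and p': "parent_tree n p'" and q': "parent_tree m q'" and i: "1 \<le> i"
    and eq: "pcomp i m p q = pcomp i m p' q'"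
  shows "p = p' \<and> q = q'"
proof -
  obtain s where s: "s \<in> {1..m}" "q s = 0" using parent_root[OF q] by blast
  have m: "1 \<le> m" using s by auto
  have qq: "q y = q' y" for y
  proof (cases "1 \<le> y \<and> y \<le> m")
    case True
    hence y: "1 \<le> y" "y \<le> m" by auto
    have "q y + i - 1 = q' y + i - 1" if "q y \<noteq> 0" "q' y \<noteq> 0"
      using pcomp_in_iff(2)[OF p q i y] pcomp_in_iff(2)[OF p' q' i y] eq that by simp
    moreover have "q y \<noteq> 0 \<longleftrightarrow> q' y \<noteq> 0"
      using pcomp_in_iff(1)[OF p q i y] pcomp_in_iff(1)[OF p' q' i y] eq by simp
    ultimately show ?thesis using i by (cases "q y = 0") auto
  next
    case False thus ?thesis using parent_outside[OF q, of y] parent_outside[OF q', of y] by auto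
  qed
  have "p y = p' y" for y
  proof (cases "y = i")
    case True
    thus ?thesis using pcomp_in_iff(3)[OF p q i, of s] pcomp_in_iff(3)[OF p' q' i, of s] s eq qq by auto
  next
    case False
    show ?thesis
      using pcomp_collapse_out[OF m relabel_outside[OF m False], of p q] pcomp_collapse_out[OF m relabel_outside[OF m False], of p' q']
        collapse_relabel[OF m False] eq by simp
  qed
  thus ?thesis using qq by auto
qed

text \<open>The inner tree keeps the edges inside the block and has the exit vertex \<open>e\<close>
  as root; in the outer tree the contracted vertex \<open>i\<close> takes over the parent of
  \<open>e\<close>. The entering condition ensures that recomposing restores the attachment
  points.\<close>

lemma good_block_decompose:
  assumes P: "parent_tree (n + m - 1) P" and i: "1 \<le> i" "i \<le> n" and m: "1 \<le> m" and g: "good_block i m P"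
  obtains p q where "parent_tree n p" "parent_tree m q" "P = pcomp i m p q"
proof -
  let ?I = "{i..<i + m}" and ?N = "n + m - 1"
  obtain e where e: "e \<in> ?I" "P e \<notin> ?I" and eu: "\<And>y. y \<in> ?I \<Longrightarrow> P y \<notin> ?I \<Longrightarrow> y = e"
    using good_block_exit[OF g] by blast
  obtain r where r: "r \<in> {1..?N}" "P r = 0" and ru: "\<And>x. x \<in> {1..?N} \<Longrightarrow> P x = 0 \<Longrightarrow> x = r"
    using parent_root[OF P] by blast
  define q where "q y = (if 1 \<le> y \<and> y \<le> m \<and> P (y + i - 1) \<in> ?I then P (y + i - 1) + 1 - i else 0)" for y
  define p where "p y = collapse i m (P (if y = i then e else relabel i m y))" for y
  have I: "?I \<subseteq> {1..?N}" using i by auto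
  have c0: "collapse i m x = 0 \<longleftrightarrow> x = 0" for x using i m by (auto simp: collapse_def)
  \<comment> \<open>Contraction is compatible with parents except at block vertices other than
    \<open>e\<close>, whose edges disappear.\<close>
  have pc: "p (collapse i m x) = collapse i m (P x)" if "x \<in> ?I \<Longrightarrow> x = e" for x
  proof (cases "x \<in> ?I")
    case True thus ?thesis using that by (simp add: p_def collapse_def)
  next
    case False
    hence "collapse i m x \<noteq> i" "relabel i m (collapse i m x) = x"
      using collapse_eq_iff[OF m] relabel_collapse[OF m] by auto
    thus ?thesis by (simp add: p_def)
  qed
  have "parent_tree m q"
  proof -
    have "q x \<le> m" for x by (auto simp: q_def)
    moreover have "q x = 0" if "x \<notin> {1..m}" for x using that by (auto simp: q_def)
    moreover have "\<exists>!x. x \<in> {1..m} \<and> q x = 0"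
    proof (rule ex1I[of _ "e + 1 - i"])
      show "e + 1 - i \<in> {1..m} \<and> q (e + 1 - i) = 0" using e by (auto simp: q_def)
      fix x assume x: "x \<in> {1..m} \<and> q x = 0"
      hence "x + i - 1 \<in> ?I" "P (x + i - 1) \<notin> ?I" using i by (auto simp: q_def split: if_splits)
      hence "x + i - 1 = e" using eu by blast
      thus "x = e + 1 - i" using x i by auto
    qed
    moreover have "\<exists>x\<in>A. q x \<notin> A" if A: "A \<subseteq> {1..m}" "A \<noteq> {}" for A
    proof -
      let ?B = "(\<lambda>x. x + i - 1) ` A"
      have B: "?B \<subseteq> {1..?N}" using A i by fastforce
      obtain x where x: "x \<in> A" "P (x + i - 1) \<notin> ?B"
        using parent_exit[OF P B] A by blast
      have "q x \<notin> A"
      proof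
        assume qx: "q x \<in> A"
        hence "q x \<noteq> 0" using A by auto
        hence "P (x + i - 1) \<in> ?I" "q x = P (x + i - 1) + 1 - i" by (auto simp: q_def split: if_splits)
        hence "P (x + i - 1) = q x + i - 1" by auto
        thus False using x qx by auto
      qed
      thus ?thesis using x by blast
    qed
    ultimately show ?thesis unfolding parent_tree_def by blast
  qed
  moreover have "parent_tree n p"
  proof -
    have "p x \<le> n" for x using parent_le[OF P, of "if x = i then e else relabel i m x"] i m
      by (auto simp: p_def collapse_def)
    moreover have "p x = 0" if "x \<notin> {1..n}" for x 
    proof -
      have "x \<noteq> i" "relabel i m x \<notin> {1..?N}" using that i m by (auto simp: relabel_def)
      thus ?thesis using parent_outside[OF P] c0 by (auto simp: p_def)
    qed
    moreover have "\<exists>!x. x \<in> {1..n} \<and> p x = 0"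
    proof (rule ex1I[of _ "collapse i m r"])
      have "r \<in> ?I \<Longrightarrow> r = e" using r i by (intro eu) auto
      thus "collapse i m r \<in> {1..n} \<and> p (collapse i m r) = 0"
        using pc[of r] r c0 collapse_bounds[OF m i] by auto
      fix x assume x: "x \<in> {1..n} \<and> p x = 0"
      let ?y = "if x = i then e else relabel i m x"
      have "P ?y = 0" using x c0 by (simp add: p_def)
      moreover have "?y \<in> {1..?N}" using x e I m by (auto simp: relabel_def)
      ultimately have "?y = r" using ru by blast
      thus "x = collapse i m r" using e collapse_relabel[OF m] collapse_eq_iff[OF m, of i e]
        by (auto split: if_splits)
    qed
    moreover have "\<exists>x\<in>A. p x \<notin> A" if A: "A \<subseteq> {1..n}" "A \<noteq> {}" for A
    proof -
      let ?B = "{x. collapse i m x \<in> A}"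
      have B: "?B \<subseteq> {1..?N}" using A collapse_bounds[OF m i] by blast
      obtain a where a: "a \<in> A" using A by auto
      have "collapse i m (if a = i then i else relabel i m a) = a"
        using collapse_eq_iff[OF m, of i i] collapse_relabel[OF m, of a i] m by auto
      hence "?B \<noteq> {}" using a by (metis empty_iff mem_Collect_eq)
      then obtain x where x: "collapse i m x \<in> A" "collapse i m (P x) \<notin> A"
        using parent_exit[OF P B] by auto
      \<comment> \<open>An edge inside the block collapses to the single vertex \<open>i\<close> and
        cannot leave the preimage of \<open>A\<close>; so an exit vertex in the block is the exit of
        the block, where \<open>pc\<close> applies.\<close>
      have "x = e" if "x \<in> ?I"
      proof (rule eu[OF that], rule notI)
        assume "P x \<in> ?I"
        hence "collapse i m (P x) = collapse i m x"
          using that by (simp add: collapse_def)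
        thus False using x by simp
      qed
      from pc[OF this] x show ?thesis by metis
    qed
    ultimately show ?thesis unfolding parent_tree_def by blast
  qed
  moreover have "P = pcomp i m p q"
  proof
    fix x
    show "P x = pcomp i m p q x"
    proof (cases "x \<in> ?I")
      case True
      hence x: "i \<le> x" "x < i + m" "x + 1 - i + i - 1 = x" "1 \<le> x + 1 - i" "x + 1 - i \<le> m" by auto
      have qx: "q (x + 1 - i) = (if P x \<in> ?I then P x + 1 - i else 0)"
        unfolding q_def x(3) using x by simp
      show ?thesis
      proof (cases "P x \<in> ?I")
        case in': True
        thus ?thesis unfolding pcomp_in[OF x(1,2)] qx by auto
      next
        case False
        hence "x = e" using eu True by blast
        hence "relabel i m (p i) = P x" using False relabel_collapse[OF m, of i "P x"] by (simp add: p_def)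
        thus ?thesis unfolding pcomp_in[OF x(1,2)] qx using False by auto
      qed
    next
      case False
      hence o: "\<not> (i \<le> x \<and> x < i + m)" by auto
      have px: "p (collapse i m x) = collapse i m (P x)" using pc False by blast
      show ?thesis unfolding pcomp_out[OF o] px collapse_eq_iff[OF m]
        using good_block_enter[OF g False] relabel_collapse[OF m, of i "P x"] by auto
    qed
  qed
  ultimately show thesis using that by blast
qed

lemma good_blocks_laminar:
  assumes p: "parent_tree n p" and I: "good_block i m p" "1 \<le> i" "i + m \<le> n + 1"
    and J: "good_block j l p" "1 \<le> j" "j + l \<le> n + 1"
  shows "\<not> (i < j \<and> j < i + m \<and> i + m < j + l)"
proof
  assume a: "i < j \<and> j < i + m \<and> i + m < j + l"
  obtain r where r: "\<And>y. y \<in> {i..<i + m} \<Longrightarrow> p y \<notin> {i..<i + m} \<Longrightarrow> y = r"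
    using good_block_exit[OF I(1)] by blast
  obtain s where s: "\<And>y. y \<in> {j..<j + l} \<Longrightarrow> p y \<notin> {j..<j + l} \<Longrightarrow> y = s"
    using good_block_exit[OF J(1)] by blast
  have "{i..<j} \<subseteq> {1..n}" "{i..<j} \<noteq> {}" using I J a by auto
  then obtain x where x: "x \<in> {i..<j}" "p x \<notin> {i..<j}" using parent_exit[OF p] by blast
  \<comment> \<open>An edge from this part into J enters from the left and ends at
    \<open>j + l - 1\<close>, beyond I. Hence the exit vertex \<open>x\<close> leaves I, so it is
    \<open>r\<close>.\<close>
  have "r \<in> {i..<j}" using x a r[of x] good_block_enter[OF J(1), of x] by fastforce
  have "{i + m..<j + l} \<subseteq> {1..n}" "{i + m..<j + l} \<noteq> {}" using I J a by auto
  then obtain y where y: "y \<in> {i + m..<j + l}" "p y \<notin> {i + m..<j + l}" using parent_exit[OF p] by blast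
  \<comment> \<open>Mirror image: an edge from here into I would end at \<open>i\<close>, to the
    left of J.\<close>
  have "s \<in> {i + m..<j + l}" using y a s[of y] good_block_enter[OF I(1), of y] by fastforce
  have "{j..<i + m} \<subseteq> {1..n}" "{j..<i + m} \<noteq> {}" using I J a by auto
  then obtain z where z: "z \<in> {j..<i + m}" "p z \<notin> {j..<i + m}" using parent_exit[OF p] by blast
  have "p z \<notin> {i..<i + m} \<or> p z \<notin> {j..<j + l}" using z a by auto
  hence "z = r \<or> z = s" using z a r s by auto
  thus False using z \<open>r \<in> _\<close> \<open>s \<in> _\<close> by auto
qed

text \<open>Labels below \<open>i\<close> keep their names under substitution. The only edge into
  the block whose source has no direct counterpart is one starting at \<open>i\<close>; in the
  composite it starts at the inner root.\<close>

lemma good_block_left: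
  assumes p: "parent_tree n p" and q: "parent_tree m q" and i: "1 \<le> i" and j: "1 \<le> j" "j + l \<le> i"
    and g: "good_block j l (pcomp i m p q)"
  shows "good_block j l p"
proof -
  let ?P = "pcomp i m p q" and ?J = "{j..<j + l}"
  obtain s where s: "s \<in> {1..m}" "q s = 0" using parent_root[OF q] by blast
  have m: "1 \<le> m" using s by auto
  have low: "?P x \<in> ?J \<longleftrightarrow> p x \<in> ?J" "p x \<in> ?J \<Longrightarrow> ?P x = p x" if "x < i" for x
    using that j m by (auto simp: pcomp_def collapse_def relabel_def)
  obtain e where e: "e \<in> ?J" "?P e \<notin> ?J" and eu: "\<And>y. y \<in> ?J \<Longrightarrow> ?P y \<notin> ?J \<Longrightarrow> y = e"
    using good_block_exit[OF g] by blast
  show ?thesis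
  proof (rule good_blockI[of e])
    show "e \<in> ?J" "p e \<notin> ?J" using e low[of e] j by auto
    show "y = e" if "y \<in> ?J" "p y \<notin> ?J" for y
      using that low[of y] j by (intro eu) auto
  next
    fix y assume y: "y \<notin> ?J" "p y \<in> ?J"
    \<comment> \<open>The vertex of the composite that carries the outgoing edge of
      \<open>y\<close>, hence the inner root for \<open>y = i\<close>. It lies on the same side of
      the block as \<open>y\<close>.\<close>
    define z where "z = (if y = i then s + i - 1 else relabel i m y)"
    have "?P z = p y"
    proof (cases "y = i")
      case True
      hence "?P z = relabel i m (p y)" using s i by (auto simp: pcomp_def z_def)
      thus ?thesis using y j by (simp add: relabel_def)
    next
      case False
      have "collapse i m (relabel i m y) = y" using False collapse_relabel m by auto
      moreover have "p y \<noteq> i" "relabel i m (p y) = p y" using y j by (auto simp: relabel_def)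
      ultimately show ?thesis using pcomp_out[OF relabel_outside[OF m False], of p q] False by (simp add: z_def)
    qed
    moreover have "z < j \<longleftrightarrow> y < j" "z \<notin> ?J" using y j s m by (auto simp: z_def relabel_def)
    ultimately show "p y = (if y < j then j + l - 1 else j)"
      using good_block_enter[OF g, of z] y by auto
  qed
qed

text \<open>Inside the substituted block the composite is \<open>q\<close> shifted by
  \<open>i - 1\<close>, apart from the edge of the inner root, which leaves the whole block and
  therefore cannot enter the smaller one.\<close>

lemma good_block_inside:
  assumes p: "parent_tree n p" and q: "parent_tree m q" and i: "1 \<le> i" and k: "1 \<le> k" "k + l \<le> m + 1"
    and g: "good_block (k + i - 1) l (pcomp i m p q)"
  shows "good_block k l q"
proof -
  let ?P = "pcomp i m p q" and ?J = "{k + i - 1..<k + i - 1 + l}" and ?K = "{k..<k + l}"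
  have K: "x + i - 1 \<in> ?J \<longleftrightarrow> x \<in> ?K" if "1 \<le> x" for x using that i k by auto
  have iff: "?P (x + i - 1) \<in> ?J \<longleftrightarrow> q x \<in> ?K" if x: "1 \<le> x" "x \<le> m" for x
  proof (cases "q x = 0")
    case True
    have "?P (x + i - 1) \<notin> {i..<i + m}" using pcomp_in_iff(1)[OF p q i x] True by auto
    thus ?thesis using True k i by auto
  next
    case False
    thus ?thesis using pcomp_in_iff(2)[OF p q i x False] K[of "q x"] by auto
  qed
  obtain e where e: "e \<in> ?J" "?P e \<notin> ?J" and eu: "\<And>y. y \<in> ?J \<Longrightarrow> ?P y \<notin> ?J \<Longrightarrow> y = e"
    using good_block_exit[OF g] by blast
  have eq: "e = (e + 1 - i) + i - 1" and e1: "e + 1 - i \<in> ?K" "1 \<le> e + 1 - i" "e + 1 - i \<le> m" using e i k by auto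
  show ?thesis
  proof (rule good_blockI[of "e + 1 - i"])
    show "e + 1 - i \<in> ?K" by fact
    show "q (e + 1 - i) \<notin> ?K" using e iff[OF e1(2,3)] eq by auto
  next
    fix y assume y: "y \<in> ?K" "q y \<notin> ?K"
    have "y + i - 1 = e" using y iff[of y] K[of y] k i by (intro eu) auto
    thus "y = e + 1 - i" using y k by auto
  next
    fix y assume y: "y \<notin> ?K" "q y \<in> ?K"
    \<comment> \<open>A parent in the block is nonzero, which rules out the default value 0 taken
      outside the vertex set.\<close>
    hence y1: "1 \<le> y" "y \<le> m" "q y \<noteq> 0" using parent_outside[OF q, of y] k by force+
    have "?P (y + i - 1) = (if y + i - 1 < k + i - 1 then k + i - 1 + l - 1 else k + i - 1)"
      using good_block_enter[OF g, of "y + i - 1"] iff[OF y1(1,2)] y K[OF y1(1)] by auto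
    thus "q y = (if y < k then k + l - 1 else k)"
      using pcomp_in_iff(2)[OF p q i y1] i k y by (auto split: if_splits)
  qed
qed

text \<open>The left block is still a block of \<open>p\<close>. Splitting \<open>p\<close> there
  and applying the parallel axiom gives a second factorization at \<open>j\<close>, which
  injectivity identifies with the given one.\<close>

lemma pcomp_disjoint_blocks:
  assumes p: "parent_tree n p" and q: "parent_tree m q" and p': "parent_tree n' p'" and q': "parent_tree m' q'"
    and eq: "pcomp i m p q = pcomp j m' p' q'" and nm: "n + m = n' + m'"
    and b: "1 \<le> m" "1 \<le> m'" "i \<le> n" "1 \<le> j" "j \<le> n'" "j + m' \<le> i"
  obtains w k r where "parent_tree w r" "j < k" "k \<le> w" "n = w + m' - 1" "n' = w + m - 1" "i = k + m' - 1"
    "p = pcomp j m' r q'" "p' = pcomp k m r q"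
proof -
  \<comment> \<open>\<open>w\<close> is the number of vertices left when both blocks are contracted,
    \<open>k\<close> the position of \<open>i\<close> after contracting the block to its
    left.\<close>
  define w k where "w = n + 1 - m'" and "k = i + 1 - m'"
  have w: "n = w + m' - 1" "n' = w + m - 1" and k: "j < k" "k \<le> w" "i = k + m' - 1" and ij: "1 \<le> i" "j \<le> w"
    using b nm by (auto simp: w_def k_def)
  have "good_block j m' (pcomp i m p q)" unfolding eq by (rule good_block_pcomp[OF p' q' b(4)])
  hence "good_block j m' p" by (rule good_block_left[OF p q ij(1) b(4) b(6)])
  then obtain r s where r: "parent_tree w r" and s: "parent_tree m' s" and prs: "p = pcomp j m' r s"
    using good_block_decompose[OF p[unfolded w] b(4) ij(2) b(2)] by metis
  have "pcomp i m p q = pcomp j m' (pcomp k m r q) s"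
    unfolding prs k(3) by (rule pcomp_parallel[OF r q s b(4) k(1,2) b(1,2), symmetric])
  hence "p' = pcomp k m r q \<and> q' = s"
    using pcomp_inject[OF p' q' _ s b(4), of "pcomp k m r q"] parent_tree_pcomp[OF r q _ k(2)] eq w(2) b k
    by simp
  thus thesis using that r k w prs by blast
qed

text \<open>The smaller block is a block of \<open>q'\<close>. Splitting \<open>q'\<close> there and
  applying the sequential axiom gives a factorization at \<open>i\<close>, identified with the given
  one by injectivity.\<close>

lemma pcomp_nested_blocks:
  assumes p: "parent_tree n p" and q: "parent_tree m q" and p': "parent_tree n' p'" and q': "parent_tree m' q'"
    and eq: "pcomp i m p q = pcomp j m' p' q'" and nm: "n + m = n' + m'"
    and b: "1 \<le> m" "1 \<le> j" "j \<le> n'" "j \<le> i" "i + m \<le> j + m'" "m < m'"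
  obtains v k r where "parent_tree v r" "2 \<le> v" "1 \<le> k" "k \<le> v" "n = n' + v - 1" "m' = v + m - 1" "i = k + j - 1"
    "p = pcomp j v p' r" "q' = pcomp k m r q"
proof -
  \<comment> \<open>\<open>v\<close> counts the vertices of \<open>q'\<close> after contracting the
    smaller block, at least 2 because \<open>m < m'\<close>; \<open>k\<close> is its position
    relative to the larger block.\<close>
  define v k where "v = m' + 1 - m" and "k = i + 1 - j"
  have v: "2 \<le> v" "n = n' + v - 1" "m' = v + m - 1" and k: "1 \<le> k" "k \<le> v" "i = k + j - 1"
    and km: "k + m \<le> m' + 1" and i: "1 \<le> i"
    using b nm by (auto simp: v_def k_def)
  have "good_block (k + j - 1) m (pcomp j m' p' q')"
    using good_block_pcomp[OF p q i] eq k by simp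
  hence "good_block k m q'" by (rule good_block_inside[OF p' q' b(2) k(1) km])
  then obtain r s where r: "parent_tree v r" and s: "parent_tree m s" and qrs: "q' = pcomp k m r s"
    using good_block_decompose[OF q'[unfolded v(3)] k(1,2) b(1)] by metis
  have "pcomp j m' p' q' = pcomp i m (pcomp j v p' r) s"
    unfolding qrs k(3) v(3) by (rule pcomp_sequential[OF p' r s b(2,3) k(1,2) b(1), symmetric])
  hence "p = pcomp j v p' r \<and> q = s"
    using pcomp_inject[OF p q _ s i, of "pcomp j v p' r"] parent_tree_pcomp[OF p' r b(2,3)] v(2) eq
    by simp
  thus thesis using that r k v qrs by blast
qed

section \<open>Parent functions and rooted trees\<close>

definition tree_of :: "nat \<Rightarrow> (nat \<Rightarrow> nat) \<Rightarrow> rtree" where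
  "tree_of n p = RTree (THE x. x \<in> {1..n} \<and> p x = 0) {(x, p x) |x. p x \<noteq> 0}"

lemma edges_tree_of: "(x, y) \<in> edges (tree_of n p) \<longleftrightarrow> p x = y \<and> y \<noteq> 0"
  by (auto simp: tree_of_def)

lemma root_tree_of:
  assumes "parent_tree n p"
  shows "root (tree_of n p) \<in> {1..n}" "p (root (tree_of n p)) = 0"
    and "x \<in> {1..n} \<Longrightarrow> p x = 0 \<Longrightarrow> root (tree_of n p) = x"
proof -
  have "root (tree_of n p) \<in> {1..n} \<and> p (root (tree_of n p)) = 0"
    using theI'[OF parent_root[OF assms]] by (simp add: tree_of_def)
  thus "root (tree_of n p) \<in> {1..n}" "p (root (tree_of n p)) = 0" by auto
  then show "x \<in> {1..n} \<Longrightarrow> p x = 0 \<Longrightarrow> root (tree_of n p) = x"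
    using parent_root[OF assms] by blast
qed

text \<open>The edges alone determine the function: a nonzero value is an edge, and 0 is the absence
  of one.\<close>

lemma tree_of_inject:
  assumes "tree_of n p = tree_of n q"
  shows "p = q"
proof
  fix x
  have "p x = y \<and> y \<noteq> 0 \<longleftrightarrow> q x = y \<and> y \<noteq> 0" for y using assms edges_tree_of by metis
  thus "p x = q x" by (metis (full_types))
qed

lemma tree_of_in_rooted_trees:
  assumes p: "parent_tree n p"
  shows "tree_of n p \<in> rooted_trees n"
proof -
  let ?E = "edges (tree_of n p)" and ?r = "root (tree_of n p)"
  let ?G = "?E \<union> ?E\<inverse>"
  have dom: "x \<in> {1..n}" if "p x \<noteq> 0" for x using parent_outside[OF p, of x] that by argo
  have ran: "p x \<in> {1..n}" if "p x \<noteq> 0" for x using parent_le[OF p, of x] that by auto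
  have sub: "?G \<subseteq> {1..n} \<times> {1..n}" using dom ran by (auto simp: edges_tree_of)
  have irr: "irrefl ?G"
    unfolding irrefl_def
  proof (intro allI notI)
    fix a assume "(a, a) \<in> ?G"
    hence "p a = a" "a \<noteq> 0" by (auto simp: edges_tree_of)
    thus False using parent_neq[OF p, of a] by simp
  qed
  have anti: "?E \<inter> ?E\<inverse> = {}"
  proof -
    have False if "p x = y" "p y = x" "x \<noteq> 0" "y \<noteq> 0" for x y
      using parent_exit[OF p, of "{x, y}"] dom that by auto
    thus ?thesis by (auto simp: edges_tree_of)
  qed
  have reach: "(a, ?r) \<in> ?E\<^sup>*" if a: "a \<in> {1..n}" for a
  proof (rule ccontr)
    \<comment> \<open>The vertices that do not reach the root form a set with an exit, but a vertex
      whose parent reaches the root, or which has no parent, reaches the root itself.\<close>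
    assume "(a, ?r) \<notin> ?E\<^sup>*"
    hence "{x \<in> {1..n}. (x, ?r) \<notin> ?E\<^sup>*} \<noteq> {}" using a by blast
    then obtain x where x: "x \<in> {1..n}" "(x, ?r) \<notin> ?E\<^sup>*" "p x \<notin> {1..n} \<or> (p x, ?r) \<in> ?E\<^sup>*"
      using parent_exit[OF p, of "{x \<in> {1..n}. (x, ?r) \<notin> ?E\<^sup>*}"] by blast
    show False
    proof (cases "p x = 0")
      case True
      thus False using root_tree_of(3)[OF p x(1)] x by auto
    next
      case False
      hence "(x, p x) \<in> ?E" by (simp add: edges_tree_of)
      thus False using x(2,3) ran[OF False] by (meson converse_rtrancl_into_rtrancl)
    qed
  qed
  have conn: "(a, b) \<in> ?G\<^sup>*" if "a \<in> {1..n}" "b \<in> {1..n}" for a b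
  proof -
    have "(a, ?r) \<in> ?G\<^sup>*" using reach[OF that(1)] by (meson rtrancl_mono subsetD sup_ge1)
    moreover have "(?r, b) \<in> (?E\<inverse>)\<^sup>*" using reach[OF that(2)] by (simp add: rtrancl_converse)
    hence "(?r, b) \<in> ?G\<^sup>*" by (meson rtrancl_mono subsetD sup_ge2)
    ultimately show ?thesis by (rule rtrancl_trans)
  qed
  have "\<not> graph_cycle ?G c" for c
  proof
    assume c: "graph_cycle ?G c"
    let ?m = "length c" and ?A = "set c"
    have m: "3 \<le> ?m" "distinct c" and step: "\<And>k. k < ?m \<Longrightarrow> (c ! k, c ! (Suc k mod ?m)) \<in> ?G"
      using c by (auto simp: graph_cycle_def)
    have "?A \<subseteq> {1..n}" using step sub by (fastforce simp: in_set_conv_nth)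
    moreover have "?A \<noteq> {}" using m by auto
    ultimately obtain x where x: "x \<in> ?A" "p x \<notin> ?A" using parent_exit[OF p] by blast
    \<comment> \<open>As \<open>p\<close> maps a vertex of the finite cycle outside it,
      \<open>p\<close> cannot cover the cycle. A vertex that is nobody's parent in the cycle must
      have both of its neighbours as its parent, which contradicts length at least 3.\<close>
    have "\<exists>l\<in>?A. l \<notin> p ` ?A"
    proof (rule ccontr)
      assume "\<not> ?thesis"
      hence "?A \<subseteq> p ` ?A" by blast
      hence "p ` ?A = ?A" using card_image_le[of ?A p] card_subset_eq[of "p ` ?A" ?A] card_mono[of "p ` ?A" ?A] 
        by (metis List.finite_set finite_imageI order_antisym)
      thus False using x by blast
    qed
    then obtain k where k: "k < ?m" "c ! k \<notin> p ` ?A" by (auto simp: in_set_conv_nth)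
    define k' where "k' = (if k = 0 then ?m - 1 else k - 1)"
    have k': "k' < ?m" "Suc k' mod ?m = k" using k m by (auto simp: k'_def)
    have sk: "Suc k mod ?m < ?m" using m by (intro mod_less_divisor) linarith
    have nb: "p (c ! k) = c ! l" if "l < ?m" "(c ! k, c ! l) \<in> ?G" for l
    proof -
      have "p (c ! l) \<noteq> c ! k" using k(2) nth_mem[OF that(1)] by (metis imageI)
      thus ?thesis using that(2) by (auto simp: edges_tree_of)
    qed
    have "p (c ! k) = c ! (Suc k mod ?m)" using nb[OF sk] step[OF k(1)] by blast
    moreover have "p (c ! k) = c ! k'" using nb[OF k'(1)] step[OF k'(1)] unfolding k'(2) by blast
    ultimately have "Suc k mod ?m = k'" using m(2) sk k' by (simp add: nth_eq_iff_index_eq)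
    moreover have "Suc k mod ?m \<noteq> k'" using k m 
      by (cases "Suc k = ?m") (auto simp: k'_def)
    ultimately show False by blast
  qed
  then show ?thesis
    unfolding rooted_trees_def tree_graph_def
    using root_tree_of(1)[OF p] sub irr conn anti reach by (auto simp: sym_Un_converse)
qed

section \<open>Paths, cycles and the parent function of a rooted tree\<close>

lemma rtrancl_distinct_path:
  assumes "(a, b) \<in> R\<^sup>*"
  obtains xs where "xs \<noteq> []" "hd xs = a" "last xs = b" "distinct xs" "successively (\<lambda>x y. (x, y) \<in> R) xs"
proof -
  have "\<exists>xs. xs \<noteq> [] \<and> hd xs = a \<and> last xs = b \<and> distinct xs \<and> successively (\<lambda>x y. (x, y) \<in> R) xs"
    using assms
  proof (induction rule: converse_rtrancl_induct)
    case base
    show ?case by (intro exI[of _ "[b]"]) auto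
  next
    case (step a a')
    then obtain xs where xs: "xs \<noteq> []" "hd xs = a'" "last xs = b" "distinct xs" "successively (\<lambda>x y. (x, y) \<in> R) xs"
      by blast
    show ?case
    proof (cases "a \<in> set xs")
      case True
      \<comment> \<open>When the new start already occurs on the path, the initial detour is cut
        off.\<close>
      then obtain ys zs where "xs = ys @ a # zs" by (meson split_list)
      thus ?thesis using xs by (intro exI[of _ "a # zs"]) (auto simp: successively_append_iff)
    next
      case False
      thus ?thesis using xs step.hyps(1)
        by (intro exI[of _ "a # xs"]) (auto simp: successively_Cons)
    qed
  qed
  thus thesis using that by blast
qed

lemma graph_cycle_of_path:
  assumes "distinct xs" "3 \<le> length xs" "successively (\<lambda>x y. (x, y) \<in> G) xs" "(last xs, hd xs) \<in> G"
  shows "graph_cycle G xs"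
proof -
  have "(xs ! k, xs ! (Suc k mod length xs)) \<in> G" if k: "k < length xs" for k
  proof (cases "Suc k = length xs")
    case True
    moreover have "xs \<noteq> []" "k = length xs - 1" using True by auto
    ultimately have "xs ! k = last xs" "xs \<noteq> []" by (simp_all add: last_conv_nth)
    thus ?thesis using assms True by (simp add: hd_conv_nth)
  next
    case False
    thus ?thesis using assms(3) k by (simp add: successively_conv_nth)
  qed
  thus ?thesis using assms by (auto simp: graph_cycle_def)
qed

text \<open>The point is that a vertex has at most one outgoing edge: two of them would lead to the
  root along paths avoiding the vertex, and together these would close an undirected cycle.\<close>

lemma rooted_trees_tree_of:
  assumes T: "T \<in> rooted_trees n"
  obtains p where "parent_tree n p" "T = tree_of n p"
proof -
  let ?E = "edges T" and ?r = "root T"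
  let ?G = "?E \<union> ?E\<inverse>"
  have r: "?r \<in> {1..n}" and sub: "?G \<subseteq> {1..n} \<times> {1..n}" and irr: "irrefl ?G"
    and nc: "\<And>c. \<not> graph_cycle ?G c" and anti: "?E \<inter> ?E\<inverse> = {}"
    and reach: "\<And>a. a \<in> {1..n} \<Longrightarrow> (a, ?r) \<in> ?E\<^sup>*"
    using T unfolding rooted_trees_def tree_graph_def by auto
  \<comment> \<open>A directed cycle of length 2 contradicts \<open>anti\<close>; a longer one is a
    \<open>graph_cycle\<close> of the underlying graph.\<close>
  have acyc: "(b, a) \<notin> ?E\<^sup>*" if ab: "(a, b) \<in> ?E" for a b
  proof
    assume "(b, a) \<in> ?E\<^sup>*"
    then obtain xs where xs: "xs \<noteq> []" "hd xs = b" "last xs = a" "distinct xs" "successively (\<lambda>x y. (x, y) \<in> ?E) xs"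
      by (rule rtrancl_distinct_path)
    have "a \<noteq> b" using irr ab by (auto simp: irrefl_def)
    consider "length xs = 1" | "length xs = 2" | "3 \<le> length xs"
      using length_greater_0_conv[of xs] xs(1) by linarith
    thus False
    proof cases
      case 1
      thus False using xs \<open>a \<noteq> b\<close> by (auto simp: length_Suc_conv)
    next
      case 2
      then obtain u v where "xs = [u, v]" by (auto simp: length_Suc_conv numeral_2_eq_2)
      thus False using xs ab anti by auto
    next
      case 3
      have "successively (\<lambda>x y. (x, y) \<in> ?G) xs" using xs(5) by (rule successively_mono) auto
      hence "graph_cycle ?G xs" using xs ab by (intro graph_cycle_of_path 3) auto
      thus False using nc by blast
    qed
  qed
  have root_out: "(?r, b) \<notin> ?E" for b
    using acyc[of ?r b] reach[of b] sub by blast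
  \<comment> \<open>A directed path that starts at or after a successor of \<open>a\<close> never
    returns to \<open>a\<close>, by \<open>acyc\<close>.\<close>
  have path_avoid: "(b, c) \<in> (Restr ?E (- {a}))\<^sup>*" if "(a, b') \<in> ?E" "(b', b) \<in> ?E\<^sup>*" "(b, c) \<in> ?E\<^sup>*" for a b b' c
    using that(3)
  proof (induction rule: rtrancl_induct)
    case base show ?case by simp
  next
    case (step y z)
    have "(b', y) \<in> ?E\<^sup>*" "(b', z) \<in> ?E\<^sup>*" using that step by (meson rtrancl_trans rtrancl.rtrancl_into_rtrancl)+
    hence "y \<noteq> a" "z \<noteq> a" using acyc[OF that(1)] by auto
    hence "(y, z) \<in> Restr ?E (- {a})" using step.hyps by simp
    with step.IH show ?case by (rule rtrancl.rtrancl_into_rtrancl)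
  qed
  have uniq: "b = c" if ab: "(a, b) \<in> ?E" and ac: "(a, c) \<in> ?E" for a b c
  proof (rule ccontr)
    assume bc: "b \<noteq> c"
    \<comment> \<open>Working in the graph without \<open>a\<close> ensures that the connecting path
      from \<open>b\<close> to \<open>c\<close> can be closed up by adding \<open>a\<close>.\<close>
    let ?R = "Restr ?G (- {a})"
    have bV: "b \<in> {1..n}" and cV: "c \<in> {1..n}" using ab ac sub by auto
    have "(b, ?r) \<in> (Restr ?E (- {a}))\<^sup>*" by (rule path_avoid[OF ab rtrancl.rtrancl_refl reach[OF bV]])
    moreover have "(Restr ?E (- {a}))\<^sup>* \<subseteq> ?R\<^sup>*" by (rule rtrancl_mono) auto
    ultimately have 1: "(b, ?r) \<in> ?R\<^sup>*" by blast
    have "(c, ?r) \<in> (Restr ?E (- {a}))\<^sup>*" by (rule path_avoid[OF ac rtrancl.rtrancl_refl reach[OF cV]])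
    hence "(?r, c) \<in> ((Restr ?E (- {a}))\<inverse>)\<^sup>*" by (simp add: rtrancl_converse)
    moreover have "((Restr ?E (- {a}))\<inverse>)\<^sup>* \<subseteq> ?R\<^sup>*" by (rule rtrancl_mono) auto
    ultimately have 2: "(?r, c) \<in> ?R\<^sup>*" by blast
    from 1 2 have "(b, c) \<in> ?R\<^sup>*" by (rule rtrancl_trans)
    then obtain xs where xs: "xs \<noteq> []" "hd xs = b" "last xs = c" "distinct xs" "successively (\<lambda>x y. (x, y) \<in> ?R) xs"
      by (rule rtrancl_distinct_path)
    have len: "2 \<le> length xs"
    proof (rule ccontr)
      assume "\<not> ?thesis"
      hence "length xs = 1" using length_greater_0_conv[of xs] xs(1) by linarith
      thus False using xs bc by (auto simp: length_Suc_conv)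
    qed
    have "a \<notin> set xs"
    proof
      assume "a \<in> set xs"
      then obtain k where k: "k < length xs" "xs ! k = a" by (auto simp: in_set_conv_nth)
      show False
      proof (cases k)
        case 0
        thus False using successively_conv_nth[THEN iffD1, OF xs(5), rule_format, of 0] k len by auto
      next
        case (Suc l)
        thus False using successively_conv_nth[THEN iffD1, OF xs(5), rule_format, of l] k len by auto
      qed
    qed
    moreover have "successively (\<lambda>x y. (x, y) \<in> ?G) xs" using xs(5) by (rule successively_mono) auto
    ultimately have "graph_cycle ?G (a # xs)"
      using xs len ab ac by (intro graph_cycle_of_path) (auto simp: successively_Cons)
    thus False using nc by blast
  qed
  define p where "p x = (if \<exists>y. (x, y) \<in> ?E then THE y. (x, y) \<in> ?E else 0)" for x
  have pE: "(x, y) \<in> ?E \<longleftrightarrow> p x = y \<and> y \<noteq> 0" for x y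
  proof
    assume xy: "(x, y) \<in> ?E"
    hence "p x = y" using uniq by (auto simp: p_def intro!: the_equality)
    thus "p x = y \<and> y \<noteq> 0" using xy sub by auto
  next
    assume a: "p x = y \<and> y \<noteq> 0"
    then obtain z where z: "(x, z) \<in> ?E" by (auto simp: p_def split: if_splits)
    hence "p x = z" using uniq by (auto simp: p_def intro!: the_equality)
    thus "(x, y) \<in> ?E" using a z by auto
  qed
  have pr: "x = ?r" if "x \<in> {1..n}" "p x = 0" for x
    using reach[OF that(1)] pE that(2) by (cases rule: converse_rtranclE) auto
  have pr0: "p ?r = 0" using root_out pE by blast
  have "p x \<le> n" for x using pE[of x "p x"] sub by (cases "p x = 0") auto
  moreover have "p x = 0" if "x \<notin> {1..n}" for x using pE[of x "p x"] sub that by (cases "p x = 0") auto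
  moreover have "\<exists>!x. x \<in> {1..n} \<and> p x = 0" using r pr pr0 by blast
  moreover have "\<exists>x\<in>A. p x \<notin> A" if A: "A \<subseteq> {1..n}" "A \<noteq> {}" for A
  proof (rule ccontr)
    \<comment> \<open>A set closed under parents contains the root with any of its members, but the
      root has value 0, which is not a vertex.\<close>
    assume c: "\<not> ?thesis"
    obtain a where a: "a \<in> A" using A by auto
    have "(a, ?r) \<in> ?E\<^sup>*" using a A reach by blast
    hence "?r \<in> A" 
      by (induction rule: rtrancl_induct) (use a c pE in auto)
    thus False using c A pr0 by fastforce
  qed
  ultimately have p: "parent_tree n p" unfolding parent_tree_def by blast
  have "?r = root (tree_of n p)" using root_tree_of(3)[OF p r pr0] by simp
  moreover have "?E = edges (tree_of n p)" using pE edges_tree_of by (intro set_eqI) (metis surj_pair)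
  ultimately have "T = tree_of n p" by (simp add: rtree.expand)
  thus thesis using that p by blast
qed

text \<open>Links the substitution of labelled trees to \<open>pcomp\<close>. The four families of
  edges are separated by their sources: two start in the block of inner labels, two outside
  it.\<close>

lemma subst_tree_tree_of:
  assumes p: "parent_tree n p" and q: "parent_tree m q" and i: "1 \<le> i" "i \<le> n"
  shows "subst_tree i m (f_Max i m) (tree_of n p) (tree_of m q) = tree_of (n + m - 1) (pcomp i m p q)"
    (is "?S = tree_of ?N ?P")
proof -
  let ?r = "root (tree_of n p)" and ?s = "root (tree_of m q)"
  note r = root_tree_of[OF p] and s = root_tree_of[OF q]
  have m: "1 \<le> m" using s(1) by auto
  have P: "parent_tree ?N ?P" by (rule parent_tree_pcomp[OF p q i])
  note ne = parent_neq[OF p i(1)]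
  have "root ?S = root (tree_of ?N ?P)"
  proof (rule root_tree_of(3)[OF P, symmetric])
    show "root ?S \<in> {1..?N}" using r(1) s(1) i m by (auto simp: subst_tree_def relabel_def)
    show "?P (root ?S) = 0"
    proof (cases "?r = i")
      case True
      have b: "i \<le> ?s + i - 1" "?s + i - 1 < i + m" "?s + i - 1 + 1 - i = ?s" using s(1) i by auto
      have "root ?S = ?s + i - 1" using True by (simp add: subst_tree_def)
      moreover have "?P (?s + i - 1) = relabel i m (p i)"
        unfolding pcomp_in[OF b(1,2)] b(3) s(2) by simp
      moreover have "p i = 0" using r(2) True by simp
      ultimately show ?thesis using i by (simp add: relabel_def)
    next
      case False
      have "root ?S = relabel i m ?r" using False by (simp add: subst_tree_def)
      moreover have "?P (relabel i m ?r) = relabel i m 0"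
        unfolding pcomp_out[OF relabel_outside[OF m False]] collapse_relabel[OF m False] r(2) using i by simp
      ultimately show ?thesis using i by (simp add: relabel_def)
    qed
  qed
  moreover
  have edges_S: "(x, y) \<in> edges ?S \<longleftrightarrow>
      (\<exists>a. q a \<noteq> 0 \<and> x = a + i - 1 \<and> y = q a + i - 1) \<or>
      (\<exists>a. a \<noteq> i \<and> p a \<noteq> i \<and> p a \<noteq> 0 \<and> x = relabel i m a \<and> y = relabel i m (p a)) \<or>
      (\<exists>a. p a = i \<and> x = relabel i m a \<and> y = f_Max i m a + i - 1) \<or>
      (p i \<noteq> 0 \<and> x = ?s + i - 1 \<and> y = relabel i m (p i))" for x y
  proof -
    have e1: "(x, y) \<in> {(a + i - 1, b + i - 1) |a b. (a, b) \<in> edges (tree_of m q)} \<longleftrightarrow>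
        (\<exists>a. q a \<noteq> 0 \<and> x = a + i - 1 \<and> y = q a + i - 1)"
      by (auto simp: edges_tree_of)
    have e2: "(x, y) \<in> {(relabel i m a, relabel i m b) |a b. (a, b) \<in> edges (tree_of n p) \<and> a \<noteq> i \<and> b \<noteq> i} \<longleftrightarrow>
        (\<exists>a. a \<noteq> i \<and> p a \<noteq> i \<and> p a \<noteq> 0 \<and> x = relabel i m a \<and> y = relabel i m (p a))"
      by (auto simp: edges_tree_of)
    have e3: "(x, y) \<in> {(relabel i m a, f_Max i m a + i - 1) |a. (a, i) \<in> edges (tree_of n p)} \<longleftrightarrow>
        (\<exists>a. p a = i \<and> x = relabel i m a \<and> y = f_Max i m a + i - 1)"
      using i by (auto simp: edges_tree_of)
    have e4: "(x, y) \<in> {(?s + i - 1, relabel i m b) |b. (i, b) \<in> edges (tree_of n p)} \<longleftrightarrow>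
        (p i \<noteq> 0 \<and> x = ?s + i - 1 \<and> y = relabel i m (p i))"
      by (auto simp: edges_tree_of)
    show ?thesis unfolding subst_tree_def rtree.sel Un_iff e1 e2 e3 e4 disj_assoc ..
  qed
  have "edges ?S = edges (tree_of ?N ?P)"
  proof (rule set_eqI, clarify)
    fix x y
    show "(x, y) \<in> edges ?S \<longleftrightarrow> (x, y) \<in> edges (tree_of ?N ?P)"
    proof (cases "i \<le> x \<and> x < i + m")
      case True
      define z where "z = x + 1 - i"
      have z: "x = z + i - 1" "1 \<le> z" "z \<le> m" using True i by (auto simp: z_def)
      \<comment> \<open>For a source in the block only the inner edges and the edge inherited by the
        inner root contribute, and they exclude each other.\<close>
      have "(x, y) \<in> edges ?S \<longleftrightarrow> (q z \<noteq> 0 \<and> y = q z + i - 1) \<or> (z = ?s \<and> p i \<noteq> 0 \<and> y = relabel i m (p i))"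
      proof -
        have rel: "x \<noteq> relabel i m a" if "a \<noteq> i" for a using relabel_outside[OF m that] True by auto
        have x: "x = a + i - 1 \<longleftrightarrow> a = z" for a using z i by auto
        have "(\<exists>a. q a \<noteq> 0 \<and> x = a + i - 1 \<and> y = q a + i - 1) \<longleftrightarrow> q z \<noteq> 0 \<and> y = q z + i - 1"
          unfolding x by blast
        moreover have "\<not> (\<exists>a. a \<noteq> i \<and> p a \<noteq> i \<and> p a \<noteq> 0 \<and> x = relabel i m a \<and> y = relabel i m (p a))"
          using rel by blast
        moreover have "\<not> (\<exists>a. p a = i \<and> x = relabel i m a \<and> y = f_Max i m a + i - 1)"
        proof -
          have "x \<noteq> relabel i m a" if "p a = i" for a using that ne by (intro rel) auto
          thus ?thesis by blast
        qed
        moreover have "x = ?s + i - 1 \<longleftrightarrow> z = ?s" unfolding x by blast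
        ultimately show ?thesis unfolding edges_S by (simp only: simp_thms conj_ac)
      qed
      also have "z = ?s \<longleftrightarrow> q z = 0" using s(2) s(3)[of z] z(2,3) by auto
      also have "(q z \<noteq> 0 \<and> y = q z + i - 1) \<or> (q z = 0 \<and> p i \<noteq> 0 \<and> y = relabel i m (p i)) \<longleftrightarrow>
          ?P x = y \<and> y \<noteq> 0"
      proof -
        have "?P x = (if q z = 0 then relabel i m (p i) else q z + i - 1)"
          using True by (simp add: pcomp_in z_def)
        moreover have "relabel i m (p i) = 0 \<longleftrightarrow> p i = 0" using relabel_eq_0_iff i m by blast
        moreover have "q z \<noteq> 0 \<Longrightarrow> q z + i - 1 \<noteq> 0" using i by simp
        ultimately show ?thesis by (cases "q z = 0") auto
      qed
      finally show ?thesis by (simp add: edges_tree_of)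
    next
      case False
      define z where "z = collapse i m x"
      have z: "z \<noteq> i" "x = relabel i m z" "z < i \<longleftrightarrow> x < i"
        using False collapse_eq_iff[OF m, of i x] relabel_collapse[OF m, of i x] by (auto simp: z_def collapse_def)
      \<comment> \<open>For a source outside the block only outer edges contribute, split according
        to whether they pointed to \<open>i\<close>.\<close>
      have "(x, y) \<in> edges ?S \<longleftrightarrow> (p z \<noteq> i \<and> p z \<noteq> 0 \<and> y = relabel i m (p z)) \<or> (p z = i \<and> y = f_Max i m z + i - 1)"
      proof -
        have rel: "x = relabel i m a \<longleftrightarrow> a = z" if "a \<noteq> i" for a
        proof
          assume "x = relabel i m a"
          thus "a = z" using collapse_relabel[OF m that] by (simp add: z_def)
        next
          assume "a = z"
          thus "x = relabel i m a" using z(2) by blast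
        qed
        have x: "x \<noteq> a + i - 1" if "1 \<le> a" "a \<le> m" for a using that False i by auto
        have "\<not> (\<exists>a. q a \<noteq> 0 \<and> x = a + i - 1 \<and> y = q a + i - 1)"
        proof clarify
          fix a assume a: "0 < q a" "x = a + i - 1"
          hence "a \<in> {1..m}" using parent_outside[OF q, of a] by fastforce
          thus False using x[of a] a(2) by simp
        qed
        moreover have "(\<exists>a. a \<noteq> i \<and> p a \<noteq> i \<and> p a \<noteq> 0 \<and> x = relabel i m a \<and> y = relabel i m (p a)) \<longleftrightarrow>
            p z \<noteq> i \<and> p z \<noteq> 0 \<and> y = relabel i m (p z)"
          using rel z(1) by metis
        moreover have "(\<exists>a. p a = i \<and> x = relabel i m a \<and> y = f_Max i m a + i - 1) \<longleftrightarrow>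
            p z = i \<and> y = f_Max i m z + i - 1"
        proof -
          have "x = relabel i m a \<longleftrightarrow> a = z" if "p a = i" for a using that ne by (intro rel) auto
          thus ?thesis by metis
        qed
        moreover have "x \<noteq> ?s + i - 1" using x s(1) by simp
        ultimately show ?thesis unfolding edges_S by (simp only: simp_thms)
      qed
      also have "\<dots> \<longleftrightarrow> ?P x = y \<and> y \<noteq> 0"
      proof -
        have "?P x = (if p z = i then f_Max i m z + i - 1 else relabel i m (p z))"
          using pcomp_out[OF False, of p q] z(3) m by (auto simp: f_Max_def z_def)
        moreover have "relabel i m (p z) = 0 \<longleftrightarrow> p z = 0" using relabel_eq_0_iff i m by blast
        moreover have "f_Max i m z + i - 1 \<noteq> 0" using i m by (simp add: f_Max_def)
        ultimately show ?thesis using i by (cases "p z = i") auto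
      qed
      finally show ?thesis by (simp add: edges_tree_of)
    qed
  qed
  ultimately show ?thesis by (simp add: rtree.expand)
qed

section \<open>Freeness of the operad of rooted trees\<close>

text \<open>Substitution in the arity-explicit shape that \<open>ns_set_operad\<close> expects of
  \<open>op\<close>.\<close>

definition subst_Max :: "nat \<Rightarrow> nat \<Rightarrow> nat \<Rightarrow> rtree \<Rightarrow> rtree \<Rightarrow> rtree" where
  "subst_Max n m i = subst_tree i m (f_Max i m)"

lemma subst_Max_tree_of:
  "1 \<le> i \<Longrightarrow> i \<le> n \<Longrightarrow> parent_tree n p \<Longrightarrow> parent_tree m q \<Longrightarrow>
    subst_Max n m i (tree_of n p) (tree_of m q) = tree_of (n + m - 1) (pcomp i m p q)"
  unfolding subst_Max_def by (rule subst_tree_tree_of)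

lemma rooted_trees_eq: "rooted_trees n = tree_of n ` {p. parent_tree n p}"
  using tree_of_in_rooted_trees by (auto elim: rooted_trees_tree_of)

lemma tree_of_one: "tree_of 1 (\<lambda>x. 0) = RTree 1 {}"
  by (auto simp: tree_of_def)

lemma ns_set_operad_trees: "ns_set_operad rooted_trees (RTree 1 {}) subst_Max"
proof
  show "rooted_trees 1 = {RTree 1 {}}"
    unfolding rooted_trees_eq parent_tree_1_iff by (simp add: tree_of_one del: One_nat_def)
next
  fix i n m T S
  assume i: "1 \<le> i" "i \<le> n" and "T \<in> rooted_trees n" "S \<in> rooted_trees m"
  then obtain p q where p: "parent_tree n p" "T = tree_of n p" and q: "parent_tree m q" "S = tree_of m q"
    unfolding rooted_trees_eq by blast
  show "subst_Max n m i T S \<in> rooted_trees (n + m - 1)"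
    unfolding p(2) q(2) subst_Max_tree_of[OF i p(1) q(1)]
    by (rule tree_of_in_rooted_trees[OF parent_tree_pcomp[OF p(1) q(1) i]])
next
  fix i n j m l T S R
  assume a: "1 \<le> i" "i \<le> n" "1 \<le> j" "j \<le> m" "1 \<le> l"
    and "T \<in> rooted_trees n" "S \<in> rooted_trees m" "R \<in> rooted_trees l"
  then obtain p q r where p: "parent_tree n p" "T = tree_of n p" and q: "parent_tree m q" "S = tree_of m q"
    and r: "parent_tree l r" "R = tree_of l r"
    unfolding rooted_trees_eq by blast
  have b: "1 \<le> j + i - 1" "j + i - 1 \<le> n + m - 1" "n + m - 1 + l - 1 = n + (m + l - 1) - 1" using a by auto
  show "subst_Max (n + m - 1) l (j + i - 1) (subst_Max n m i T S) R =
      subst_Max n (m + l - 1) i T (subst_Max m l j S R)"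
    unfolding p(2) q(2) r(2) subst_Max_tree_of[OF a(1,2) p(1) q(1)] subst_Max_tree_of[OF a(3,4) q(1) r(1)]
      subst_Max_tree_of[OF b(1,2) parent_tree_pcomp[OF p(1) q(1) a(1,2)] r(1)]
      subst_Max_tree_of[OF a(1,2) p(1) parent_tree_pcomp[OF q(1) r(1) a(3,4)]]
      pcomp_sequential[OF p(1) q(1) r(1) a] b(3) ..
next
  fix i n j m l T S R
  assume a: "1 \<le> j" "j < i" "i \<le> n" "1 \<le> m" "1 \<le> l"
    and "T \<in> rooted_trees n" "S \<in> rooted_trees m" "R \<in> rooted_trees l"
  then obtain p q r where p: "parent_tree n p" "T = tree_of n p" and q: "parent_tree m q" "S = tree_of m q"
    and r: "parent_tree l r" "R = tree_of l r"
    unfolding rooted_trees_eq by blast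
  have b: "1 \<le> i" "j \<le> n" "j \<le> n + m - 1" "1 \<le> i + l - 1" "i + l - 1 \<le> n + l - 1"
    "n + m - 1 + l - 1 = n + l - 1 + m - 1" using a by auto
  show "subst_Max (n + m - 1) l j (subst_Max n m i T S) R =
      subst_Max (n + l - 1) m (i + l - 1) (subst_Max n l j T R) S"
    unfolding p(2) q(2) r(2) subst_Max_tree_of[OF b(1) a(3) p(1) q(1)] subst_Max_tree_of[OF a(1) b(2) p(1) r(1)]
      subst_Max_tree_of[OF a(1) b(3) parent_tree_pcomp[OF p(1) q(1) b(1) a(3)] r(1)]
      subst_Max_tree_of[OF b(4,5) parent_tree_pcomp[OF p(1) r(1) a(1) b(2)] q(1)]
      pcomp_parallel[OF p(1) q(1) r(1) a] b(6) ..
next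
  fix n T
  assume n: "1 \<le> n" and "T \<in> rooted_trees n"
  then obtain p where p: "parent_tree n p" "T = tree_of n p" unfolding rooted_trees_eq by blast
  have u: "parent_tree 1 (\<lambda>x. 0)" by (simp only: parent_tree_1_iff)
  show "subst_Max 1 n 1 (RTree 1 {}) T = T"
    unfolding p(2) tree_of_one[symmetric] subst_Max_tree_of[OF le_refl le_refl u p(1)] pcomp_unit_left[OF p(1)]
    by simp
next
  fix i n T
  assume i: "1 \<le> i" "i \<le> n" and "T \<in> rooted_trees n"
  then obtain p where p: "parent_tree n p" "T = tree_of n p" unfolding rooted_trees_eq by blast
  have u: "parent_tree 1 (\<lambda>x. 0)" by (simp only: parent_tree_1_iff)
  show "subst_Max n 1 i T (RTree 1 {}) = T"
    unfolding p(2) tree_of_one[symmetric] subst_Max_tree_of[OF i p(1) u] pcomp_unit_right[OF i(1)]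
    by simp
qed

interpretation trees: ns_set_operad rooted_trees "RTree 1 {}" subst_Max
  by (rule ns_set_operad_trees)

lemma disjoint_factors_trees:
  assumes p: "parent_tree n p" and q: "parent_tree m q" and p': "parent_tree n' p'" and q': "parent_tree m' q'"
    and eq: "pcomp i m p q = pcomp j m' p' q'" and nm: "n + m = n' + m'"
    and b: "1 \<le> m" "1 \<le> m'" "i \<le> n" "1 \<le> j" "j \<le> n'" "j + m' \<le> i"
  shows "trees.disjoint_factors n m i (tree_of n p) (tree_of m q) n' m' j (tree_of n' p') (tree_of m' q')"
proof -
  obtain w k r where r: "parent_tree w r" and k: "j < k" "k \<le> w" "n = w + m' - 1" "n' = w + m - 1" "i = k + m' - 1"
    "p = pcomp j m' r q'" "p' = pcomp k m r q"
    using pcomp_disjoint_blocks[OF p q p' q' eq nm b] .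
  have jk: "j \<le> w" "1 \<le> k" using k b(4) by auto
  have "tree_of n p = subst_Max w m' j (tree_of w r) (tree_of m' q')"
    "tree_of n' p' = subst_Max w m k (tree_of w r) (tree_of m q)"
    unfolding subst_Max_tree_of[OF b(4) jk(1) r q'] subst_Max_tree_of[OF jk(2) k(2) r q] k(3,4,6,7) by simp_all
  thus ?thesis
    unfolding trees.disjoint_factors_def using tree_of_in_rooted_trees[OF r] b(4) k(1-5) by blast
qed

lemma nested_factors_trees:
  assumes p: "parent_tree n p" and q: "parent_tree m q" and p': "parent_tree n' p'" and q': "parent_tree m' q'"
    and eq: "pcomp i m p q = pcomp j m' p' q'" and nm: "n + m = n' + m'"
    and b: "1 \<le> m" "1 \<le> j" "j \<le> n'" "j \<le> i" "i + m \<le> j + m'" "m < m'"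
  shows "trees.nested_factors n m i (tree_of n p) (tree_of m q) n' m' j (tree_of n' p') (tree_of m' q')"
proof -
  obtain v k r where r: "parent_tree v r" and k: "2 \<le> v" "1 \<le> k" "k \<le> v" "n = n' + v - 1" "m' = v + m - 1" "i = k + j - 1"
    "p = pcomp j v p' r" "q' = pcomp k m r q"
    using pcomp_nested_blocks[OF p q p' q' eq nm b] .
  have "tree_of n p = subst_Max n' v j (tree_of n' p') (tree_of v r)"
    "tree_of m' q' = subst_Max v m k (tree_of v r) (tree_of m q)"
    unfolding subst_Max_tree_of[OF b(2,3) p' r] subst_Max_tree_of[OF k(2,3) r q] k(4,5,7,8) by simp_all
  thus ?thesis
    unfolding trees.nested_factors_def using tree_of_in_rooted_trees[OF r] k(1-6) by blast
qed

interpretation trees: free_ns_set_operad rooted_trees "RTree 1 {}" subst_Max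
proof
  fix n m n' m' i j T S T' S'
  assume ge: "2 \<le> n" "2 \<le> m" "2 \<le> n'" "2 \<le> m'" and i: "1 \<le> i" "i \<le> n" and j: "1 \<le> j" "j \<le> n'"
    and X: "T \<in> rooted_trees n" "S \<in> rooted_trees m" "T' \<in> rooted_trees n'" "S' \<in> rooted_trees m'"
    and nm: "n + m = n' + m'" and TS: "subst_Max n m i T S = subst_Max n' m' j T' S'"
  obtain p where p: "parent_tree n p" "T = tree_of n p" using rooted_trees_tree_of[OF X(1)] .
  obtain q where q: "parent_tree m q" "S = tree_of m q" using rooted_trees_tree_of[OF X(2)] .
  obtain p' where p': "parent_tree n' p'" "T' = tree_of n' p'" using rooted_trees_tree_of[OF X(3)] .
  obtain q' where q': "parent_tree m' q'" "S' = tree_of m' q'" using rooted_trees_tree_of[OF X(4)] .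
  have "tree_of (n + m - 1) (pcomp i m p q) = tree_of (n + m - 1) (pcomp j m' p' q')"
    using TS unfolding p(2) q(2) p'(2) q'(2) subst_Max_tree_of[OF i p(1) q(1)] subst_Max_tree_of[OF j p'(1) q'(1)] nm .
  hence eq: "pcomp i m p q = pcomp j m' p' q'" by (rule tree_of_inject)
  have P: "parent_tree (n + m - 1) (pcomp i m p q)" by (rule parent_tree_pcomp[OF p(1) q(1) i])
  have g: "good_block i m (pcomp i m p q)" by (rule good_block_pcomp[OF p(1) q(1) i(1)])
  have g': "good_block j m' (pcomp i m p q)" unfolding eq by (rule good_block_pcomp[OF p'(1) q'(1) j(1)])
  have bounds: "i + m \<le> n + m - 1 + 1" "j + m' \<le> n + m - 1 + 1" using i j ge nm by auto
  have lam: "\<not> (i < j \<and> j < i + m \<and> i + m < j + m')" "\<not> (j < i \<and> i < j + m' \<and> j + m' < i + m)"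
    using good_blocks_laminar[OF P g i(1) bounds(1) g' j(1) bounds(2)]
      good_blocks_laminar[OF P g' j(1) bounds(2) g i(1) bounds(1)] by auto
  have m: "1 \<le> m" "1 \<le> m'" using ge by auto
  \<comment> \<open>Intervals that do not overlap properly are equal, disjoint in one of two orders,
    or nested. Nested intervals of equal length coincide, so the nested cases may be taken
    strict.\<close>
  consider (eq) "i = j" "m = m'" | (l) "j + m' \<le> i" | (r) "i + m \<le> j"
    | (n1) "j \<le> i" "i + m \<le> j + m'" "m < m'" | (n2) "i \<le> j" "j + m' \<le> i + m" "m' < m"
    using lam by linarith
  thus "n = n' \<and> m = m' \<and> i = j \<and> T = T' \<and> S = S' \<or>
     trees.disjoint_factors n m i T S n' m' j T' S' \<or> trees.disjoint_factors n' m' j T' S' n m i T S \<or>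
     trees.nested_factors n m i T S n' m' j T' S' \<or> trees.nested_factors n' m' j T' S' n m i T S"
  proof cases
    case eq
    hence n: "n = n'" using nm by simp
    have "p = p' \<and> q = q'"
      using pcomp_inject[OF p(1) q(1) _ _ i(1), of p' q'] p'(1) q'(1) \<open>pcomp i m p q = _\<close> n eq by simp
    thus ?thesis using p(2) q(2) p'(2) q'(2) n eq by simp
  next
    case l
    show ?thesis unfolding p(2) q(2) p'(2) q'(2)
      using disjoint_factors_trees[OF p(1) q(1) p'(1) q'(1) \<open>pcomp i m p q = _\<close> nm m i(2) j l] by blast
  next
    case r
    show ?thesis unfolding p(2) q(2) p'(2) q'(2)
      using disjoint_factors_trees[OF p'(1) q'(1) p(1) q(1) \<open>pcomp i m p q = _\<close>[symmetric] nm[symmetric] m(2,1) j(2) i r] by blast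
  next
    case n1
    show ?thesis unfolding p(2) q(2) p'(2) q'(2)
      using nested_factors_trees[OF p(1) q(1) p'(1) q'(1) \<open>pcomp i m p q = _\<close> nm m(1) j n1] by blast
  next
    case n2
    show ?thesis unfolding p(2) q(2) p'(2) q'(2)
      using nested_factors_trees[OF p'(1) q'(1) p(1) q(1) \<open>pcomp i m p q = _\<close>[symmetric] nm[symmetric] m(2) i n2] by blast
  qed
qed

theorem theorem3p3:
  shows "free_operad TYPE('b :: ab_group_add) (T_Max :: ('k :: field, rtree \<Rightarrow>\<^sub>0 'k) operad)"
proof -
  have *: "(T_Max :: ('k, rtree \<Rightarrow>\<^sub>0 'k) operad) = trees.linearization"
    unfolding T_Max_def trees.linearization_def subst_Max_def ..
  show ?thesis
    unfolding * by (rule trees.free_operad_linearization)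
qed

end
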